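(* Let $k\ge 2$ and let $\mathsf{A}=(A_1,\dots,A_k)\in \mathrm{GL}(2,\mathbb{R})^k$. Suppose that the one-step cocycle generated by $\mathsf{A}$ is dominated. For each $\star\in\{\top,\bot\}$, let $K^\star\subset\{1,\dots,k\}^{\mathbb{Z}}$ be the union of the supports of all measures $\mu\in\mathcal{M}_T$ such that $\lambda_1(A,\mu)=\lambda_1^\star(\mathsf{A})$. Then, for each $\star\in\{\top,\bot\}$: (i) $K^\star$ is a compact, nonempty, $T$-invariant set; (ii) any measure $\mu\in\mathcal{M}_T$ supported in $K^\star$ satisfies $\lambda_1(A,\mu)=\lambda_1^\star(\mathsf{A})$.
   Context: Let $k^{\mathbb{Z}}=\{1,\dots,k\}^{\mathbb{Z}}$ with the product topology, and let $T$ be the shift, $(T\omega)_n=\omega_{n+1}$. $\mathcal{M}_T$ is the set of $T$-invariant Borel probability measures on $k^{\mathbb{Z}}$. The one-step cocycle generated by $\mathsf{A}=(A_1,\dots,A_k)$ is the pair $(T,A)$ with $A(\omega)=A_{\omega_0}$; its products are $A^{(n)}(\omega)=A_{\omega_{n-1}}\cdots A_{\omega_0}$ for $n\ge 0$ ($A^{(0)}(\omega)=\mathrm{Id}$). With $\|\cdot\|$ the Euclidean operator norm, $\lambda_1(A,\omega)=\lim_{n\to+\infty}\frac1n\log\|A^{(n)}(\omega)\|$, which exists for $\mu$-almost every $\omega$ for each $\mu\in\mathcal{M}_T$; $\lambda_1(A,\mu)=\int\lambda_1(A,\omega)\,d\mu(\omega)$; $\lambda_1^\top(\mathsf{A})=\sup_{\mu\in\mathcal{M}_T}\lambda_1(A,\mu)$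 and $\lambda_1^\bot(\mathsf{A})=\inf_{\mu\in\mathcal{M}_T}\lambda_1(A,\mu)$. The cocycle is dominated if for each $\omega\in k^{\mathbb{Z}}$ there is a splitting $\mathbb{R}^2=e_1(\omega)\oplus e_2(\omega)$ into one-dimensional subspaces such that $A(\omega)(e_i(\omega))=e_i(T\omega)$ for all $\omega$ and $i\in\{1,2\}$, and there are constants $c>0$, $\delta>0$ with $\|A^{(n)}(\omega)|e_1(\omega)\|\ge c e^{\delta n}\|A^{(n)}(\omega)|e_2(\omega)\|$ for all $\omega$ and $n\ge1$. *)

theory Defs
  imports "HOL-Probability.Probability"
begin

text \<open>
  The space \<open>{1..k}\<close> to the power of the integers is a subset of the type \<open>int \<Rightarrow> nat\<close>, whose
  topology is the product of the discrete topologies on \<open>nat\<close>; the subspace topology is thus the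
  product topology.
\<close>

definition full_shift :: "nat \<Rightarrow> (int \<Rightarrow> nat) set" where
  "full_shift k = {\<omega>. \<forall>n. \<omega> n \<in> {1..k}}"

definition left_shift :: "(int \<Rightarrow> nat) \<Rightarrow> (int \<Rightarrow> nat)" where
  "left_shift \<omega> = (\<lambda>n. \<omega> (n + 1))"

definition invariant_measures :: "nat \<Rightarrow> (int \<Rightarrow> nat) measure set" where
  "invariant_measures k =
     {\<mu>. prob_space \<mu> \<and> sets \<mu> = sets (restrict_space borel (full_shift k)) \<and>
         distr \<mu> \<mu> left_shift = \<mu>}"

text \<open>Measurability of the shift, without which the term \<open>distr \<mu> \<mu> left_shift\<close> above would not be
  the push-forward measure.\<close>

lemma left_shift_measurable:
  assumes "sets \<mu> = sets (restrict_space borel (full_shift k))"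
  shows "left_shift \<in> measurable \<mu> \<mu>"
proof -
  have "continuous_on UNIV left_shift"
    unfolding left_shift_def by (intro continuous_on_coordinatewise_then_product) auto
  then have "left_shift \<in> borel_measurable borel"
    by (rule borel_measurable_continuous_onI)
  moreover have "left_shift \<in> full_shift k \<rightarrow> full_shift k"
    by (auto simp: left_shift_def full_shift_def)
  ultimately have "left_shift \<in> measurable (restrict_space borel (full_shift k))
                                      (restrict_space borel (full_shift k))"
    by (intro measurable_restrict_space3)
  then show ?thesis
    using assms measurable_cong_sets by blast
qed

text \<open>Topological support of a measure living on \<open>full_shift k\<close>.\<close>

definition msupport :: "nat \<Rightarrow> (int \<Rightarrow> nat) measure \<Rightarrow> (int \<Rightarrow> nat) set" where
  "msupport k \<mu> =
     {\<omega> \<in> full_shift k. \<forall>U. open U \<and> \<omega> \<in> U \<longrightarrow> emeasure \<mu> (U \<inter> full_shift k) > 0}"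

primrec cocycle_prod :: "(nat \<Rightarrow> real^2^2) \<Rightarrow> nat \<Rightarrow> (int \<Rightarrow> nat) \<Rightarrow> real^2^2" where
  "cocycle_prod A 0 \<omega> = mat 1"
| "cocycle_prod A (Suc n) \<omega> = A (\<omega> (int n)) ** cocycle_prod A n \<omega>"

definition lyap_pt :: "(nat \<Rightarrow> real^2^2) \<Rightarrow> (int \<Rightarrow> nat) \<Rightarrow> real" where
  "lyap_pt A \<omega> = lim (\<lambda>n. 1 / real n * ln (onorm ((*v) (cocycle_prod A n \<omega>))))"

definition lyap :: "(nat \<Rightarrow> real^2^2) \<Rightarrow> (int \<Rightarrow> nat) measure \<Rightarrow> real" where
  "lyap A \<mu> = (LINT \<omega>|\<mu>. lyap_pt A \<omega>)"

definition lyap_top :: "nat \<Rightarrow> (nat \<Rightarrow> real^2^2) \<Rightarrow> real" where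
  "lyap_top k A = (SUP \<mu>\<in>invariant_measures k. lyap A \<mu>)"

definition lyap_bot :: "nat \<Rightarrow> (nat \<Rightarrow> real^2^2) \<Rightarrow> real" where
  "lyap_bot k A = (INF \<mu>\<in>invariant_measures k. lyap A \<mu>)"

text \<open>Operator norm of the restriction of \<open>M\<close> to the subspace \<open>E\<close>; as in the definition of
  \<^const>\<open>onorm\<close>, the vector \<open>0\<close> contributes \<open>0 / 0 = 0\<close>.\<close>

definition norm_on :: "real^2^2 \<Rightarrow> (real^2) set \<Rightarrow> real" where
  "norm_on M E = (SUP v\<in>E. norm (M *v v) / norm v)"

definition splitting :: "(real^2) set \<Rightarrow> (real^2) set \<Rightarrow> bool" where
  "splitting E F \<longleftrightarrow>
     subspace E \<and> subspace F \<and> dim E = 1 \<and> dim F = 1 \<and>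
     E \<inter> F = {0} \<and> {u + v | u v. u \<in> E \<and> v \<in> F} = UNIV"

definition dominated :: "nat \<Rightarrow> (nat \<Rightarrow> real^2^2) \<Rightarrow> bool" where
  "dominated k A \<longleftrightarrow>
     (\<exists>e1 e2 :: (int \<Rightarrow> nat) \<Rightarrow> (real^2) set.
        (\<forall>\<omega>\<in>full_shift k. splitting (e1 \<omega>) (e2 \<omega>) \<and>
           (*v) (A (\<omega> 0)) ` e1 \<omega> = e1 (left_shift \<omega>) \<and>
           (*v) (A (\<omega> 0)) ` e2 \<omega> = e2 (left_shift \<omega>)) \<and>
        (\<exists>c>0. \<exists>\<delta>>0. \<forall>\<omega>\<in>full_shift k. \<forall>n\<ge>1.
           norm_on (cocycle_prod A n \<omega>) (e1 \<omega>)
             \<ge> c * exp (\<delta> * real n) * norm_on (cocycle_prod A n \<omega>) (e2 \<omega>)))"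

definition extremal_set :: "nat \<Rightarrow> (nat \<Rightarrow> real^2^2) \<Rightarrow> real \<Rightarrow> (int \<Rightarrow> nat) set" where
  "extremal_set k A l = (\<Union>\<mu>\<in>{\<mu> \<in> invariant_measures k. lyap A \<mu> = l}. msupport k \<mu>)"

end

theory Submission
  imports Defs
begin

text \<open>
  Write \<open>a n \<omega>\<close> for the logarithm of the norm of the \<open>n\<close>-step product. Domination enters only
  through one consequence: up to a constant \<open>C\<close>, the sequence \<open>a\<close> is additive along orbits
  (\<open>dominated_almost_additive_potential\<close>). Indeed the norm is comparable to the norm along the
  dominating line, which is multiplicative; the comparison needs the angle between the two lines to
  be bounded below, and this holds because at some fixed time one line is stretched twice as much
  as the other by one of finitely many invertible matrices.

  Almost additivity implies, by a maximal ergodic argument, that \<open>a n \<omega> / n\<close> converges almost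
  everywhere and that the integral of \<open>a n\<close> differs from \<open>n\<close> times the Lyapunov exponent by at
  most \<open>C\<close> (\<open>integral_lim_approx\<close>). Each \<open>a n\<close> is locally constant, so the exponent is a uniform
  limit of weakly continuous affine functions of the measure.

  Let \<open>l\<close> be the supremum of the exponents. It is attained, by weak compactness
  (\<open>invariant_measures_cluster\<close>). Testing on periodic orbits shows that \<open>a n\<close> never exceeds
  \<open>n * l\<close> by more than \<open>3 * C\<close> (\<open>a_le_top_rate\<close>). Conversely, on the support of a maximizing
  measure \<open>a n\<close> cannot fall below \<open>n * l\<close> by more than \<open>5 * C + 1\<close> (\<open>deficient_null\<close>): a worse word
  would recur with positive mean frequency, each occurrence would lose more than almost additivity
  can compensate elsewhere, and the losses would add up. So on the union of the
  maximizing supports \<open>a n\<close> is within a constant of \<open>n * l\<close>, and every invariant measure living there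
  has exponent \<open>l\<close> (\<open>lam_eq_top_rate_if_msupport_subset\<close>). The union is closed because it is the
  support of one maximizing measure, a countable mixture (\<open>maximizing_set_eq_msupport\<close>).

  Changing the sign of \<open>a\<close> exchanges suprema and infima and preserves almost additivity, so the
  minimizing case is an instance of the maximizing one.
\<close>

section \<open>Growth rates of almost additive processes\<close>

lemma measure_preserving_funpow:
  assumes "T \<in> measurable M M" "distr M M T = M"
  shows "T ^^ n \<in> measurable M M" "distr M M (T ^^ n) = M"
proof -
  show "T ^^ n \<in> measurable M M"
    using assms(1) by (rule measurable_compose_n)
  then show "distr M M (T ^^ n) = M"
  proof (induction n)
    case 0
    show ?case by (simp add: id_def distr_id)
  next
    case (Suc n)
    have n: "T ^^ n \<in> measurable M M"
      using assms(1) by (rule measurable_compose_n)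
    have "distr M M (T ^^ Suc n) = distr (distr M M (T ^^ n)) M T"
      by (subst distr_distr[OF assms(1) n]) (simp add: comp_def)
    then show ?case
      using Suc.IH[OF n] assms(2) by (simp add: comp_def)
  qed
qed

lemma integral_measure_preserving:
  fixes g :: "'a \<Rightarrow> real"
  assumes "T \<in> measurable M M" "distr M M T = M" "g \<in> borel_measurable M"
  shows "(\<integral>\<omega>. g ((T ^^ n) \<omega>) \<partial>M) = (\<integral>\<omega>. g \<omega> \<partial>M)"
  using integral_distr[OF measure_preserving_funpow(1)[OF assms(1,2)] assms(3), of n]
    measure_preserving_funpow(2)[OF assms(1,2), of n] by simp

text \<open>The maxima \<open>h n\<close> of the Birkhoff sums of length at most \<open>n\<close> (the empty sum included) satisfy a
  recursion which shows that, where \<open>h (Suc n)\<close> is positive, \<open>g\<close> dominates the coboundary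
  \<open>h (Suc n) - h (Suc n) \<circ> T\<close>. Coboundaries integrate to zero, and by hypothesis the sets where
  \<open>h (Suc n)\<close> is positive exhaust the space.\<close>

lemma (in finite_measure) maximal_ergodic:
  fixes g :: "'a \<Rightarrow> real"
  assumes T[measurable]: "T \<in> measurable M M" and T_inv: "distr M M T = M"
    and g[measurable]: "g \<in> borel_measurable M"
    and B: "\<And>\<omega>. \<omega> \<in> space M \<Longrightarrow> \<bar>g \<omega>\<bar> \<le> B"
    and pos: "\<And>\<omega>. \<omega> \<in> space M \<Longrightarrow> \<exists>n. (\<Sum>i<n. g ((T ^^ i) \<omega>)) > 0"
  shows "0 \<le> (\<integral>\<omega>. g \<omega> \<partial>M)"
proof -
  define h where "h = rec_nat (\<lambda>\<omega>. 0) (\<lambda>_ f \<omega>. max 0 (g \<omega> + f (T \<omega>)))"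
  have h0: "h 0 = (\<lambda>\<omega>. 0)" and hS: "h (Suc n) = (\<lambda>\<omega>. max 0 (g \<omega> + h n (T \<omega>)))" for n
    by (auto simp: h_def)
  have T_sp: "T \<omega> \<in> space M" if "\<omega> \<in> space M" for \<omega>
    using measurable_space[OF T that] .
  have h_meas[measurable]: "h n \<in> borel_measurable M" for n
    by (induction n) (simp_all add: h0 hS)
  have h_nonneg: "0 \<le> h n \<omega>" for n \<omega>
    by (cases n) (auto simp: h0 hS)
  have h_bd: "h n \<omega> \<le> real n * B" if "\<omega> \<in> space M" for n \<omega>
    using that
  proof (induction n arbitrary: \<omega>)
    case (Suc n)
    show ?case
      using Suc.IH[OF T_sp[OF Suc.prems]] B[OF Suc.prems] by (auto simp: hS algebra_simps)
  qed (simp add: h0)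
  have h_mono: "h n \<omega> \<le> h (Suc n) \<omega>" for n \<omega>
  proof (induction n arbitrary: \<omega>)
    case (Suc n)
    from Suc.IH[of "T \<omega>"] show ?case
      unfolding hS[of "Suc n"] hS[of n] by (intro max.mono add_mono) (simp_all add: hS)
  qed (simp add: h0 hS)
  have S_le: "(\<Sum>i<n. g ((T ^^ i) \<omega>)) \<le> h n \<omega>" for n \<omega>
  proof (induction n arbitrary: \<omega>)
    case (Suc n)
    have "(\<Sum>i<Suc n. g ((T ^^ i) \<omega>)) = g \<omega> + (\<Sum>i<n. g ((T ^^ i) (T \<omega>)))"
      by (simp add: sum.lessThan_Suc_shift funpow_swap1 del: sum.lessThan_Suc)
    then show ?case
      using Suc.IH[of "T \<omega>"] by (auto simp: hS max_def)
  qed (simp add: h0)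
  have int_h: "integrable M (h n)" for n
    using h_nonneg h_bd by (intro integrable_const_bound[where B="real n * B"]) auto
  have int_g: "integrable M g"
    using B by (intro integrable_const_bound[where B=B]) auto
  have int_hT: "integrable M (\<lambda>\<omega>. h n (T \<omega>))" for n
    using h_nonneg h_bd T_sp by (intro integrable_const_bound[where B="real n * B"]) auto
  \<comment> \<open>Where \<open>h (Suc n)\<close> is positive it equals \<open>g + h n \<circ> T\<close>, so its coboundary is at most \<open>g\<close>.\<close>
  have ind: "0 \<le> (\<integral>\<omega>. g \<omega> * indicator {\<omega> \<in> space M. 0 < h (Suc n) \<omega>} \<omega> \<partial>M)" for n
  proof -
    have eq: "(\<integral>\<omega>. h (Suc n) (T \<omega>) \<partial>M) = (\<integral>\<omega>. h (Suc n) \<omega> \<partial>M)"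
      using integral_measure_preserving[OF T T_inv h_meas, of "Suc n" 1] by simp
    have "0 = (\<integral>\<omega>. h (Suc n) \<omega> - h (Suc n) (T \<omega>) \<partial>M)"
      by (subst Bochner_Integration.integral_diff[OF int_h int_hT]) (simp add: eq)
    also have "\<dots> \<le> (\<integral>\<omega>. g \<omega> * indicator {\<omega> \<in> space M. 0 < h (Suc n) \<omega>} \<omega> \<partial>M)"
    proof (rule integral_mono)
      show "integrable M (\<lambda>\<omega>. h (Suc n) \<omega> - h (Suc n) (T \<omega>))"
        by (intro Bochner_Integration.integrable_diff int_h int_hT)
      show "integrable M (\<lambda>\<omega>. g \<omega> * indicator {\<omega> \<in> space M. 0 < h (Suc n) \<omega>} \<omega>)"
        using integrable_real_mult_indicator[OF _ int_g] by measurable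
      fix \<omega> assume "\<omega> \<in> space M"
      then show "h (Suc n) \<omega> - h (Suc n) (T \<omega>)
          \<le> g \<omega> * indicator {\<omega> \<in> space M. 0 < h (Suc n) \<omega>} \<omega>"
        using h_mono[of n "T \<omega>"] h_nonneg[of "Suc n" "T \<omega>"]
        by (auto simp: hS indicator_def max_def split: if_splits)
    qed
    finally show ?thesis .
  qed
  have "(\<lambda>n. \<integral>\<omega>. g \<omega> * indicator {\<omega> \<in> space M. 0 < h (Suc n) \<omega>} \<omega> \<partial>M)
      \<longlonglongrightarrow> (\<integral>\<omega>. g \<omega> \<partial>M)"
  proof (rule integral_dominated_convergence[where w="\<lambda>_. B"])
    show "AE \<omega> in M. (\<lambda>n. g \<omega> * indicator {\<omega> \<in> space M. 0 < h (Suc n) \<omega>} \<omega>) \<longlonglongrightarrow> g \<omega>"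
    proof (rule AE_I2)
      fix \<omega> assume w: "\<omega> \<in> space M"
      obtain N where N: "0 < h N \<omega>"
        using pos[OF w] S_le order_less_le_trans by blast
      have "0 < h (Suc n) \<omega>" if "n \<ge> N" for n
        using N lift_Suc_mono_le[of "\<lambda>n. h n \<omega>" N "Suc n"] h_mono that by force
      then have "\<forall>\<^sub>F n in sequentially.
          g \<omega> * indicator {\<omega> \<in> space M. 0 < h (Suc n) \<omega>} \<omega> = g \<omega>"
        using w by (auto simp: eventually_sequentially intro!: exI[of _ N])
      then show "(\<lambda>n. g \<omega> * indicator {\<omega> \<in> space M. 0 < h (Suc n) \<omega>} \<omega>) \<longlonglongrightarrow> g \<omega>"
        by (rule tendsto_eventually)
    qed
    show "AE \<omega> in M. norm (g \<omega> * indicator {\<omega> \<in> space M. 0 < h (Suc n) \<omega>} \<omega>) \<le> B" for n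
      using B by (intro AE_I2) (auto simp: indicator_def intro: order_trans[OF abs_ge_zero])
  qed auto
  then show ?thesis
    using ind by (intro LIMSEQ_le_const) auto
qed

text \<open>Passing through the extended reals keeps \<open>limsup\<close> measurable in parameters; for a sequence of at
  most linear growth the value is the actual upper limit (\<open>ereal_upper_rate\<close>).\<close>

definition upper_rate :: "(nat \<Rightarrow> real) \<Rightarrow> real" where
  "upper_rate x = real_of_ereal (limsup (\<lambda>n. ereal (x n / real n)))"

context
  fixes x :: "nat \<Rightarrow> real" and B :: real
  assumes x_le: "\<And>n. \<bar>x n\<bar> \<le> B * real n"
begin

lemma ratio_bound: "\<bar>x n / real n\<bar> \<le> B"
proof (cases "n = 0")
  case True
  have "0 \<le> B" using x_le[of 1] by simp
  then show ?thesis using True by simp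
qed (use x_le[of n] in \<open>simp add: abs_divide divide_le_eq\<close>)

lemma ereal_upper_rate: "ereal (upper_rate x) = limsup (\<lambda>n. ereal (x n / real n))"
  and abs_upper_rate_le: "\<bar>upper_rate x\<bar> \<le> B"
proof -
  let ?L = "limsup (\<lambda>n. ereal (x n / real n))"
  have b: "- B \<le> x n / real n" "x n / real n \<le> B" for n
    using ratio_bound[of n] by (simp_all only: abs_le_iff) linarith
  have "?L \<le> ereal B"
    using b by (intro Limsup_bounded) auto
  moreover have "ereal (- B) \<le> ?L"
    using b by (intro order_trans[OF Liminf_bounded Liminf_le_Limsup]) auto
  ultimately show "ereal (upper_rate x) = ?L" "\<bar>upper_rate x\<bar> \<le> B"
    unfolding upper_rate_def by (cases ?L; auto)+
qed

lemma upper_rate_frequently: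
  assumes "r < upper_rate x"
  shows "\<exists>n\<ge>N. r < x n / real n"
proof (rule ccontr)
  assume "\<not> (\<exists>n\<ge>N. r < x n / real n)"
  then have "\<forall>\<^sub>F n in sequentially. ereal (x n / real n) \<le> ereal r"
    by (auto simp: eventually_sequentially not_less)
  then have "limsup (\<lambda>n. ereal (x n / real n)) \<le> ereal r"
    by (rule Limsup_bounded)
  then show False
    using assms ereal_upper_rate by (metis ereal_less_eq(3) not_le)
qed

lemma upper_rate_eventually:
  assumes "upper_rate x < r"
  shows "\<forall>\<^sub>F n in sequentially. x n / real n < r"
  using assms Limsup_lessD[of sequentially "\<lambda>n. ereal (x n / real n)" "ereal r"] ereal_upper_rate
  by (metis (mono_tags, lifting) ereal_less_eq(3) eventually_mono not_le)

end

text \<open>The two sequences of ratios differ by \<open>O(1/n)\<close>. This is what makes the growth rate of an almost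
  additive process invariant under the underlying map.\<close>

lemma upper_rate_shift:
  assumes "\<And>n. \<bar>x n\<bar> \<le> B * real n" "\<And>n. \<bar>x (Suc n) - y n\<bar> \<le> D"
  shows "upper_rate y = upper_rate x"
proof -
  have "(\<lambda>n. y n / real n - x (Suc n) / real (Suc n)) \<longlonglongrightarrow> 0"
  proof (rule Lim_null_comparison)
    show "\<forall>\<^sub>F n in sequentially. norm (y n / real n - x (Suc n) / real (Suc n)) \<le> (D + B) / real n"
    proof (rule eventually_sequentiallyI[of 1])
      fix n :: nat assume n: "1 \<le> n"
      have "y n / real n - x (Suc n) / real (Suc n)
          = (y n - x (Suc n)) / real n + x (Suc n) / (real n * real (Suc n))"
      proof -
        have "u / r - v / (1 + r) = (u - v) / r + v / (r * (1 + r))" if "r > 0" for u v r :: real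
        proof -
          have "v / (r * (1 + r)) = v / r - v / (1 + r)"
            using that by (simp add: field_simps)
          then show ?thesis by (simp add: diff_divide_distrib)
        qed
        from this[of "real n"] show ?thesis using n by simp
      qed
      also have "norm \<dots> \<le> \<bar>y n - x (Suc n)\<bar> / real n + \<bar>x (Suc n)\<bar> / (real n * real (Suc n))"
        by (metis (no_types) abs_divide abs_mult abs_of_nat abs_triangle_ineq real_norm_def)
      also have "\<dots> \<le> D / real n + B * real (Suc n) / (real n * real (Suc n))"
        using assms(1)[of "Suc n"] assms(2)[of n]
        by (intro add_mono divide_right_mono) (auto simp: abs_minus_commute)
      also have "\<dots> = (D + B) / real n"
        using n by (simp add: add_divide_distrib)
      finally show "norm (y n / real n - x (Suc n) / real (Suc n)) \<le> (D + B) / real n" .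
    qed
    show "(\<lambda>n. (D + B) / real n) \<longlonglongrightarrow> 0"
      by (rule lim_const_over_n)
  qed
  then have "(\<lambda>n. ereal (y n / real n - x (Suc n) / real (Suc n))) \<longlonglongrightarrow> ereal 0"
    by (intro tendsto_ereal)
  from ereal_limsup_lim_add[OF this, of "\<lambda>n. ereal (x (Suc n) / real (Suc n))"]
  have "limsup (\<lambda>n. ereal (y n / real n)) = limsup (\<lambda>n. ereal (x (Suc n) / real (Suc n)))"
    by (simp add: zero_ereal_def[symmetric])
  also have "\<dots> = limsup (\<lambda>n. ereal (x n / real n))"
    using limsup_shift[of "\<lambda>n. ereal (x n / real n)"] by simp
  finally show ?thesis
    by (simp add: upper_rate_def)
qed

locale almost_additive_process = prob_space M for M :: "'a measure" +
  fixes T :: "'a \<Rightarrow> 'a" and a :: "nat \<Rightarrow> 'a \<Rightarrow> real" and C B :: real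
  assumes T_meas[measurable]: "T \<in> measurable M M" and T_inv: "distr M M T = M"
    and a_meas[measurable]: "\<And>n. a n \<in> borel_measurable M"
    and a_add: "\<And>n m \<omega>. \<omega> \<in> space M \<Longrightarrow> \<bar>a (n + m) \<omega> - a n \<omega> - a m ((T ^^ n) \<omega>)\<bar> \<le> C"
    and a_bound: "\<And>n \<omega>. \<omega> \<in> space M \<Longrightarrow> \<bar>a n \<omega>\<bar> \<le> B * real n"
begin

lemma iterate_space: "\<omega> \<in> space M \<Longrightarrow> (T ^^ n) \<omega> \<in> space M"
  by (induction n) (auto intro: measurable_space[OF T_meas])

lemma integrable_a: "integrable M (a n)"
  using a_bound[of _ n] by (intro integrable_const_bound[where B="B * real n"]) auto

definition rate :: "'a \<Rightarrow> real" where
  "rate \<omega> = upper_rate (\<lambda>n. a n \<omega>)"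

lemma rate_meas[measurable]: "rate \<in> borel_measurable M"
  unfolding rate_def upper_rate_def by measurable

lemma rate_abs_le: "\<omega> \<in> space M \<Longrightarrow> \<bar>rate \<omega>\<bar> \<le> B"
  unfolding rate_def using a_bound by (intro abs_upper_rate_le) auto

lemma integrable_rate: "integrable M rate"
  using rate_abs_le by (intro integrable_const_bound[where B=B]) auto

lemma rate_T: "\<omega> \<in> space M \<Longrightarrow> rate (T \<omega>) = rate \<omega>"
proof -
  assume w: "\<omega> \<in> space M"
  have "\<bar>a (Suc n) \<omega> - a n (T \<omega>)\<bar> \<le> C + B" for n
    using a_add[OF w, of 1 n] a_bound[OF w, of 1] by simp
  then show ?thesis
    unfolding rate_def using a_bound[OF w] by (intro upper_rate_shift)
qed

lemma rate_iterate: "\<omega> \<in> space M \<Longrightarrow> rate ((T ^^ n) \<omega>) = rate \<omega>"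
  by (induction n) (auto simp: rate_T iterate_space)

lemma block_sum:
  assumes "\<omega> \<in> space M"
  shows "a (q * m) \<omega> \<le> (\<Sum>j<m. a q ((T ^^ (q * j)) \<omega>)) + real m * C"
proof (induction m)
  case (Suc m)
  then show ?case
    using a_add[OF assms, of "q * m" q] by (simp add: algebra_simps abs_le_iff)
qed (use a_bound[OF assms, of 0] in simp)

text \<open>Fed to the maximal ergodic inequality for \<open>T ^^ q\<close>, the function
  \<open>a q - q * rate + C + e\<close> has a positive Birkhoff sum at every point, because the sums of
  \<open>a q\<close> along \<open>T ^^ q\<close> dominate the process itself up to the constant \<open>C\<close> per block.\<close>

lemma integral_rate_le:
  assumes q: "q \<ge> 1"
  shows "real q * (\<integral>\<omega>. rate \<omega> \<partial>M) \<le> (\<integral>\<omega>. a q \<omega> \<partial>M) + C"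
proof (rule field_le_epsilon)
  fix e :: real assume e: "e > 0"
  define g where "g \<omega> = a q \<omega> - real q * rate \<omega> + (C + e)" for \<omega>
  have "0 \<le> (\<integral>\<omega>. g \<omega> \<partial>M)"
  proof (rule maximal_ergodic[of "T ^^ q" g "B * real q + real q * B + \<bar>C + e\<bar>"])
    show "T ^^ q \<in> measurable M M" "distr M M (T ^^ q) = M"
      using measure_preserving_funpow[OF T_meas T_inv] by auto
    show "g \<in> borel_measurable M"
      unfolding g_def by measurable
    fix \<omega> assume w: "\<omega> \<in> space M"
    have "\<bar>real q * rate \<omega>\<bar> \<le> real q * B"
      using rate_abs_le[OF w] by (simp add: abs_mult mult_left_mono)
    then show "\<bar>g \<omega>\<bar> \<le> B * real q + real q * B + \<bar>C + e\<bar>"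
      using a_bound[OF w, of q] unfolding g_def by linarith
    have bd: "\<And>n. \<bar>a n \<omega>\<bar> \<le> B * real n"
      by (rule a_bound[OF w])
    have B0: "0 \<le> B" using bd[of 1] by simp
    have C0: "0 \<le> C" using a_add[OF w, of 0 0] by linarith
    let ?s = "\<lambda>m. \<Sum>j<m. g (((T ^^ q) ^^ j) \<omega>)"
    have s: "?s m \<ge> a (q * m) \<omega> - real (q * m) * rate \<omega> + real m * e" for m
    proof -
      have "?s m = (\<Sum>j<m. a q ((T ^^ (q * j)) \<omega>) + (- real q * rate \<omega> + (C + e)))"
        unfolding g_def
        by (rule sum.cong) (simp_all add: funpow_mult rate_iterate[OF w])
      also have "\<dots> = (\<Sum>j<m. a q ((T ^^ (q * j)) \<omega>)) + real m * (- real q * rate \<omega> + (C + e))"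
        by (simp add: sum.distrib)
      finally show ?thesis
        using block_sum[OF w, of q m] by (simp add: algebra_simps)
    qed
    \<comment> \<open>The error of replacing \<open>n\<close> by the multiple \<open>q * (n div q)\<close>, in \<open>a\<close> and in \<open>n * rate\<close>.\<close>
    define D where "D = B * real q + C + real q * B + e"
    obtain N :: nat where N: "real N > 2 * (D / e) + 1"
      using reals_Archimedean2 by blast
    obtain n where n: "n \<ge> q * N" "rate \<omega> - e / (2 * real q) < a n \<omega> / real n"
      using upper_rate_frequently[of "\<lambda>n. a n \<omega>" B "rate \<omega> - e / (2 * real q)" "q * N", OF bd] e q
      unfolding rate_def by auto
    have "q * N > 0"
    proof -
      have "D / e \<ge> 0" unfolding D_def using B0 C0 e by simp
      then have "N > 0" using N by (cases N) auto
      then show ?thesis using q by simp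
    qed
    then have n_pos: "n > 0" using n(1) by linarith
    define m r where "m = n div q" and "r = n mod q"
    have nmr: "n = q * m + r" and r: "r < q" and mN: "m \<ge> N"
      unfolding m_def r_def using q n(1)
      by (auto simp: less_eq_div_iff_mult_less_eq mult.commute)
    have rn: "real n = real q * real m + real r" using nmr by simp
    have an: "a n \<omega> > real n * rate \<omega> - real n * (e / (2 * real q))"
      using n(2) n_pos by (simp add: less_divide_eq algebra_simps)
    have "real n * (e / (2 * real q)) \<le> (real q * (real m + 1)) * (e / (2 * real q))"
      using rn r e by (intro mult_right_mono) (auto simp: algebra_simps)
    also have "\<dots> = (real m + 1) * e / 2" using q by (simp add: field_simps)
    finally have ne: "real n * (e / (2 * real q)) \<le> (real m + 1) * e / 2" .
    have "\<bar>a r ((T ^^ (q * m)) \<omega>)\<bar> \<le> B * real q"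
      using order_trans[OF a_bound[OF iterate_space[OF w], of r "q * m"] mult_left_mono] r B0 by auto
    then have aq: "a (q * m) \<omega> \<ge> a n \<omega> - B * real q - C"
      using a_add[OF w, of "q * m" r] nmr by simp
    have "\<bar>real r * rate \<omega>\<bar> \<le> real q * B"
      using r rate_abs_le[OF w] unfolding abs_mult by (intro mult_mono) auto
    then have rr: "real n * rate \<omega> \<ge> real (q * m) * rate \<omega> - real q * B"
      using rn by (simp add: algebra_simps abs_le_iff)
    have "real m > 2 * (D / e) + 1" using N mN by linarith
    then have "(real m - 1) * e / 2 > D"
      using e by (simp add: field_simps)
    then have "?s m > 0"
      using s[of m] aq an ne rr e unfolding D_def by (simp add: field_simps)
    then show "\<exists>n. 0 < ?s n" by blast
  qed
  also have "(\<integral>\<omega>. g \<omega> \<partial>M) = (\<integral>\<omega>. a q \<omega> \<partial>M) - real q * (\<integral>\<omega>. rate \<omega> \<partial>M) + (C + e)"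
    unfolding g_def using integrable_a integrable_rate by (simp add: prob_space)
  finally show "real q * (\<integral>\<omega>. rate \<omega> \<partial>M) \<le> (\<integral>\<omega>. a q \<omega> \<partial>M) + C + e"
    by simp
qed

end

lemma (in almost_additive_process) uminus_process:
  "almost_additive_process M T (\<lambda>n \<omega>. - a n \<omega>) C B"
proof unfold_locales
  fix n m \<omega> assume w: "\<omega> \<in> space M"
  show "\<bar>- a (n + m) \<omega> - - a n \<omega> - - a m ((T ^^ n) \<omega>)\<bar> \<le> C"
    using a_add[OF w, of n m] by linarith
  show "\<bar>- a n \<omega>\<bar> \<le> B * real n"
    using a_bound[OF w] by simp
qed (use T_inv in auto)

context almost_additive_process
begin

text \<open>The inequality \<open>integral_rate_le\<close>, used for the process and for its negative, says that \<open>q\<close> times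
  the integrated gap between upper and lower rate is at most \<open>2 * C\<close>, for every \<open>q\<close>. So the gap
  vanishes almost everywhere, and the same two inequalities then bound the integrals.\<close>

lemma AE_tendsto_rate: "AE \<omega> in M. (\<lambda>n. a n \<omega> / real n) \<longlonglongrightarrow> rate \<omega>"
  and integral_rate_approx: "\<bar>(\<integral>\<omega>. a q \<omega> \<partial>M) - real q * (\<integral>\<omega>. rate \<omega> \<partial>M)\<bar> \<le> C"
proof -
  interpret neg: almost_additive_process M T "\<lambda>n \<omega>. - a n \<omega>" C B
    by (rule uminus_process)
  have upper: "real q * (\<integral>\<omega>. rate \<omega> \<partial>M) \<le> (\<integral>\<omega>. a q \<omega> \<partial>M) + C" if "q \<ge> 1" for q
    using integral_rate_le that .
  have lower: "real q * (\<integral>\<omega>. neg.rate \<omega> \<partial>M) \<le> - (\<integral>\<omega>. a q \<omega> \<partial>M) + C" if "q \<ge> 1" for q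
    using neg.integral_rate_le[OF that] by simp
  have nonneg: "0 \<le> rate \<omega> + neg.rate \<omega>" if w: "\<omega> \<in> space M" for \<omega>
  proof (rule ccontr)
    assume neg: "\<not> 0 \<le> rate \<omega> + neg.rate \<omega>"
    define r where "r = (rate \<omega> - neg.rate \<omega>) / 2"
    have "rate \<omega> < r" "neg.rate \<omega> < - r"
      using neg unfolding r_def by (simp_all add: field_simps)
    then have "\<forall>\<^sub>F n in sequentially. a n \<omega> / real n < r"
      "\<forall>\<^sub>F n in sequentially. - a n \<omega> / real n < - r"
      using upper_rate_eventually[of "\<lambda>n. a n \<omega>" B r] a_bound[OF w]
        upper_rate_eventually[of "\<lambda>n. - a n \<omega>" B "- r"]
      unfolding rate_def neg.rate_def by auto
    then have "\<forall>\<^sub>F n in sequentially. False"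
      by eventually_elim simp
    then show False by simp
  qed
  have sum_le: "(\<integral>\<omega>. rate \<omega> + neg.rate \<omega> \<partial>M) \<le> 0"
  proof (rule ccontr)
    assume "\<not> ?thesis"
    then have p: "(\<integral>\<omega>. rate \<omega> + neg.rate \<omega> \<partial>M) > 0" by simp
    obtain q :: nat where q: "real q * (\<integral>\<omega>. rate \<omega> + neg.rate \<omega> \<partial>M) > \<bar>2 * C\<bar>"
      using reals_Archimedean3[OF p] by blast
    then have "q \<ge> 1" by (cases q) auto
    then have "real q * (\<integral>\<omega>. rate \<omega> \<partial>M) + real q * (\<integral>\<omega>. neg.rate \<omega> \<partial>M) \<le> 2 * C"
      using upper lower by fastforce
    then show False
      using q integrable_rate neg.integrable_rate by (simp add: algebra_simps)
  qed
  have "(\<integral>\<omega>. rate \<omega> + neg.rate \<omega> \<partial>M) = 0"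
    using sum_le nonneg by (intro antisym integral_nonneg_AE AE_I2)
  then have sum0: "AE \<omega> in M. rate \<omega> + neg.rate \<omega> = 0"
    using integral_nonneg_eq_0_iff_AE[of M "\<lambda>\<omega>. rate \<omega> + neg.rate \<omega>"] integrable_rate
      neg.integrable_rate nonneg by simp
  then show "AE \<omega> in M. (\<lambda>n. a n \<omega> / real n) \<longlonglongrightarrow> rate \<omega>"
  proof (rule AE_mp, intro AE_I2 impI)
    fix \<omega> assume w: "\<omega> \<in> space M" and 0: "rate \<omega> + neg.rate \<omega> = 0"
    show "(\<lambda>n. a n \<omega> / real n) \<longlonglongrightarrow> rate \<omega>"
    proof (rule order_tendstoI)
      fix r assume "r < rate \<omega>"
      then have "neg.rate \<omega> < - r" using 0 by linarith
      then have "\<forall>\<^sub>F n in sequentially. - a n \<omega> / real n < - r"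
        using upper_rate_eventually[of "\<lambda>n. - a n \<omega>" B "- r"] a_bound[OF w]
        unfolding neg.rate_def by auto
      then show "\<forall>\<^sub>F n in sequentially. r < a n \<omega> / real n"
        by eventually_elim simp
    next
      fix r assume "rate \<omega> < r"
      then show "\<forall>\<^sub>F n in sequentially. a n \<omega> / real n < r"
        using upper_rate_eventually[of "\<lambda>n. a n \<omega>" B r] a_bound[OF w]
        unfolding rate_def by auto
    qed
  qed
  have "(\<integral>\<omega>. rate \<omega> \<partial>M) + (\<integral>\<omega>. neg.rate \<omega> \<partial>M) = 0"
    using \<open>(\<integral>\<omega>. rate \<omega> + neg.rate \<omega> \<partial>M) = 0\<close> integrable_rate neg.integrable_rate by simp
  then have neg_eq: "(\<integral>\<omega>. neg.rate \<omega> \<partial>M) = - (\<integral>\<omega>. rate \<omega> \<partial>M)"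
    by linarith
  show "\<bar>(\<integral>\<omega>. a q \<omega> \<partial>M) - real q * (\<integral>\<omega>. rate \<omega> \<partial>M)\<bar> \<le> C"
  proof (cases "q \<ge> 1")
    case True
    then show ?thesis
      using upper[OF True] lower[OF True] unfolding neg_eq by simp
  next
    case False
    then have "q = 0" by simp
    moreover obtain w where w: "w \<in> space M" using not_empty by blast
    moreover have "(\<integral>\<omega>. a 0 \<omega> \<partial>M) = (\<integral>\<omega>. 0 \<partial>M)"
      using a_bound[of _ 0] by (intro Bochner_Integration.integral_cong) auto
    ultimately show ?thesis
      using a_add[OF w, of 0 0] by auto
  qed
qed

text \<open>Almost everywhere the limit exists and is the rate, which determines the integral whatever value
  \<open>lim\<close> takes on the exceptional null set.\<close>

lemma integral_lim_approx:
  "\<bar>(\<integral>\<omega>. a q \<omega> \<partial>M) - real q * (\<integral>\<omega>. lim (\<lambda>n. 1 / real n * a n \<omega>) \<partial>M)\<bar> \<le> C"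
proof -
  have "(\<integral>\<omega>. lim (\<lambda>n. 1 / real n * a n \<omega>) \<partial>M) = (\<integral>\<omega>. rate \<omega> \<partial>M)"
  proof (rule integral_cong_AE)
    show "(\<lambda>\<omega>. lim (\<lambda>n. 1 / real n * a n \<omega>)) \<in> borel_measurable M"
      by measurable
    show "AE \<omega> in M. lim (\<lambda>n. 1 / real n * a n \<omega>) = rate \<omega>"
      using AE_tendsto_rate by eventually_elim (simp add: limI)
  qed measurable
  then show ?thesis
    using integral_rate_approx by simp
qed

end

section \<open>The full shift and locally constant functions\<close>

lemma compact_PiE_UNIV:
  fixes K :: "'i \<Rightarrow> 'b::topological_space set"
  assumes "\<And>i. compact (K i)"
  shows "compact (PiE UNIV K)"
proof -
  have "compactin (product_topology (\<lambda>i. euclidean) UNIV) (PiE UNIV K)"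
    using assms by (auto simp: compactin_PiE)
  then show ?thesis
    by (simp add: euclidean_product_topology)
qed

lemma compact_full_shift: "compact (full_shift k)"
proof -
  have "full_shift k = PiE UNIV (\<lambda>_. {1..k})"
    by (auto simp: full_shift_def)
  then show ?thesis
    using compact_PiE_UNIV[of "\<lambda>_. {1..k}"] by (simp add: finite_imp_compact)
qed

lemma closed_full_shift: "closed (full_shift k)"
proof -
  have "full_shift k = (\<Inter>n. (\<lambda>\<omega>. \<omega> n) -` {1..k})"
    by (auto simp: full_shift_def)
  also have "closed \<dots>"
    by (intro closed_INT ballI closed_vimage continuous_on_product_coordinates finite_imp_closed) simp
  finally show ?thesis .
qed

lemma left_shift_funpow: "(left_shift ^^ n) \<omega> = (\<lambda>i. \<omega> (i + int n))"
  by (induction n) (auto simp: left_shift_def algebra_simps)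

lemma left_shift_full_shift: "\<omega> \<in> full_shift k \<Longrightarrow> left_shift \<omega> \<in> full_shift k"
  by (auto simp: left_shift_def full_shift_def)

lemma left_shift_funpow_full_shift:
  "\<omega> \<in> full_shift k \<Longrightarrow> (left_shift ^^ n) \<omega> \<in> full_shift k"
  by (auto simp: left_shift_funpow full_shift_def)

lemma continuous_left_shift: "continuous_on UNIV left_shift"
  unfolding left_shift_def by (intro continuous_on_coordinatewise_then_product) auto

definition right_shift :: "(int \<Rightarrow> nat) \<Rightarrow> (int \<Rightarrow> nat)" where
  "right_shift \<omega> = (\<lambda>n. \<omega> (n - 1))"

lemma right_shift_simps [simp]:
  "right_shift (left_shift \<omega>) = \<omega>" "left_shift (right_shift \<omega>) = \<omega>"
  by (auto simp: left_shift_def right_shift_def)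

lemma right_shift_full_shift: "\<omega> \<in> full_shift k \<Longrightarrow> right_shift \<omega> \<in> full_shift k"
  by (auto simp: right_shift_def full_shift_def)

lemma continuous_right_shift: "continuous_on UNIV right_shift"
  unfolding right_shift_def by (intro continuous_on_coordinatewise_then_product) auto

text \<open>Continuity with respect to the discrete topology on the codomain.\<close>

definition locally_constant :: "('a::topological_space \<Rightarrow> 'b) \<Rightarrow> bool" where
  "locally_constant f \<longleftrightarrow> (\<forall>S. open (f -` S))"

text \<open>A function of finitely many coordinates is constant on open cylinders.\<close>

lemma locally_constantI_cylinder:
  fixes f :: "(int \<Rightarrow> nat) \<Rightarrow> 'b"
  assumes F: "finite F" and f: "\<And>x y. (\<And>i. i \<in> F \<Longrightarrow> x i = y i) \<Longrightarrow> f x = f y"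
  shows "locally_constant f"
  unfolding locally_constant_def
proof
  fix S
  have "open (\<Inter>i\<in>F. (\<lambda>y::int \<Rightarrow> nat. y i) -` {x i})" for x
    using F by (intro open_INT ballI open_vimage) (auto intro: Topological_Spaces.open_discrete)
  then have "open (\<Union>x\<in>f -` S. \<Inter>i\<in>F. (\<lambda>y. y i) -` {x i})"
    by blast
  also have "(\<Union>x\<in>f -` S. \<Inter>i\<in>F. (\<lambda>y. y i) -` {x i}) = f -` S"
    using f by fastforce
  finally show "open (f -` S)" .
qed

lemma locally_constant_compose: "locally_constant f \<Longrightarrow> locally_constant (\<lambda>x. g (f x))"
proof -
  assume f: "locally_constant f"
  have "(\<lambda>x. g (f x)) -` S = f -` (g -` S)" for S by auto
  then show ?thesis using f by (simp add: locally_constant_def)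
qed

lemma locally_constant_continuous:
  fixes f :: "'a::topological_space \<Rightarrow> 'b::topological_space"
  shows "locally_constant f \<Longrightarrow> continuous_on UNIV f"
  by (auto simp: locally_constant_def continuous_on_open_vimage)

lemma locally_constant_finite_image:
  assumes f: "locally_constant f" and K: "compact K"
  shows "finite (f ` K)"
proof -
  obtain D where D: "D \<subseteq> f ` K" "finite D" "K \<subseteq> (\<Union>v\<in>D. f -` {v})"
  proof (rule compactE_image[OF K])
    show "open (f -` {v})" for v
      using f by (simp add: locally_constant_def)
    show "K \<subseteq> (\<Union>v\<in>f ` K. f -` {v})" by blast
  qed
  have "f ` K \<subseteq> D"
    using D(3) by auto
  then show ?thesis
    using D(2) by (rule finite_subset)
qed

section \<open>Invariant measures and their supports\<close>

context
  fixes k :: nat and \<mu> :: "(int \<Rightarrow> nat) measure"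
  assumes \<mu>: "\<mu> \<in> invariant_measures k"
begin

lemma invariant_measure_prob: "prob_space \<mu>"
  and invariant_measure_sets: "sets \<mu> = sets (restrict_space borel (full_shift k))"
  and invariant_measure_distr: "distr \<mu> \<mu> left_shift = \<mu>"
  using \<mu> by (auto simp: invariant_measures_def)

lemma invariant_measure_space: "space \<mu> = full_shift k"
  using sets_eq_imp_space_eq[OF invariant_measure_sets] by (simp add: space_restrict_space)

lemma invariant_measure_meas: "left_shift \<in> measurable \<mu> \<mu>"
  by (rule left_shift_measurable[OF invariant_measure_sets])

lemma invariant_measure_open: "open U \<Longrightarrow> U \<inter> full_shift k \<in> sets \<mu>"
  unfolding invariant_measure_sets using closed_full_shift by (auto simp: sets_restrict_space)

lemma emeasure_shift_vimage:
  assumes "open U"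
  shows "emeasure \<mu> (left_shift -` U \<inter> full_shift k) = emeasure \<mu> (U \<inter> full_shift k)"
proof -
  have "emeasure \<mu> (U \<inter> full_shift k) = emeasure (distr \<mu> \<mu> left_shift) (U \<inter> full_shift k)"
    by (simp add: invariant_measure_distr)
  also have "\<dots> = emeasure \<mu> (left_shift -` (U \<inter> full_shift k) \<inter> space \<mu>)"
    by (rule emeasure_distr[OF invariant_measure_meas invariant_measure_open[OF assms]])
  also have "left_shift -` (U \<inter> full_shift k) \<inter> space \<mu> = left_shift -` U \<inter> full_shift k"
    by (auto simp: invariant_measure_space left_shift_full_shift)
  finally show ?thesis by simp
qed

lemma locally_constant_measurable:
  fixes f :: "(int \<Rightarrow> nat) \<Rightarrow> 'b::topological_space"
  assumes "locally_constant f"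
  shows "f \<in> borel_measurable \<mu>"
proof -
  have "f \<in> borel_measurable borel"
    using assms by (intro borel_measurable_continuous_onI locally_constant_continuous)
  then have "f \<in> borel_measurable (restrict_space borel (full_shift k))"
    by (rule measurable_restrict_space1)
  then show ?thesis
    using measurable_cong_sets[OF invariant_measure_sets refl] by blast
qed

lemma locally_constant_integrable:
  fixes f :: "(int \<Rightarrow> nat) \<Rightarrow> real"
  assumes "locally_constant f"
  shows "integrable \<mu> f"
proof -
  interpret prob_space \<mu> by (rule invariant_measure_prob)
  have fin: "finite (f ` full_shift k)"
    using assms compact_full_shift by (rule locally_constant_finite_image)
  show ?thesis
    using fin
    by (intro integrable_const_bound[where B="Max (abs ` f ` full_shift k)"] AE_I2
        locally_constant_measurable assms) (auto simp: invariant_measure_space)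
qed

lemma integral_locally_constant:
  fixes f :: "(int \<Rightarrow> nat) \<Rightarrow> real"
  assumes f: "locally_constant f"
  shows "(\<integral>\<omega>. f \<omega> \<partial>\<mu>) = (\<Sum>v\<in>f ` full_shift k. v * measure \<mu> (f -` {v} \<inter> full_shift k))"
proof -
  interpret prob_space \<mu> by (rule invariant_measure_prob)
  have fin: "finite (f ` full_shift k)"
    using f compact_full_shift by (rule locally_constant_finite_image)
  have lev: "f -` {v} \<inter> full_shift k \<in> sets \<mu>" for v
    using f by (intro invariant_measure_open) (auto simp: locally_constant_def)
  have "(\<integral>\<omega>. f \<omega> \<partial>\<mu>)
      = (\<integral>\<omega>. (\<Sum>v\<in>f ` full_shift k. v * indicator (f -` {v} \<inter> full_shift k) \<omega>) \<partial>\<mu>)"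
  proof (intro Bochner_Integration.integral_cong refl)
    fix \<omega> assume "\<omega> \<in> space \<mu>"
    then have "\<omega> \<in> full_shift k" by (simp add: invariant_measure_space)
    then have "(\<Sum>v\<in>f ` full_shift k. v * indicator (f -` {v} \<inter> full_shift k) \<omega>)
        = (\<Sum>v\<in>f ` full_shift k. if v = f \<omega> then v else 0)"
      by (intro sum.cong) (auto simp: indicator_def)
    then show "f \<omega> = (\<Sum>v\<in>f ` full_shift k. v * indicator (f -` {v} \<inter> full_shift k) \<omega>)"
      using fin \<open>\<omega> \<in> full_shift k\<close> by simp
  qed
  also have "\<dots> = (\<Sum>v\<in>f ` full_shift k. v * measure \<mu> (f -` {v} \<inter> full_shift k))"
    using lev by (subst Bochner_Integration.integral_sum) (auto simp: emeasure_eq_measure)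
  finally show ?thesis .
qed

text \<open>Outside the support every point has a null neighbourhood; compactness of the full shift makes
  finitely many of them suffice.\<close>

lemma null_if_disjoint_msupport:
  assumes K: "closed K" "K \<inter> msupport k \<mu> = {}"
  shows "emeasure \<mu> (K \<inter> full_shift k) = 0"
proof -
  define \<U> where "\<U> = {U. open U \<and> emeasure \<mu> (U \<inter> full_shift k) = 0}"
  have comp: "compact (K \<inter> full_shift k)"
    using K(1) compact_full_shift by (rule closed_Int_compact)
  obtain D where D: "D \<subseteq> \<U>" "finite D" "K \<inter> full_shift k \<subseteq> \<Union>D"
  proof (rule compactE[OF comp])
    show "K \<inter> full_shift k \<subseteq> \<Union>\<U>"
    proof
      fix x assume "x \<in> K \<inter> full_shift k"
      then have "x \<in> full_shift k" "x \<notin> msupport k \<mu>" using K(2) by auto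
      then obtain U where "open U" "x \<in> U" "\<not> emeasure \<mu> (U \<inter> full_shift k) > 0"
        unfolding msupport_def by blast
      then show "x \<in> \<Union>\<U>"
        by (auto simp: \<U>_def zero_less_iff_neq_zero)
    qed
    show "open U" if "U \<in> \<U>" for U
      using that by (simp add: \<U>_def)
  qed
  have null: "(\<Union>U\<in>D. U \<inter> full_shift k) \<in> null_sets \<mu>"
    using D(1,2) invariant_measure_open by (intro null_sets.finite_UN) (auto simp: \<U>_def)
  have "K \<inter> full_shift k \<subseteq> (\<Union>U\<in>D. U \<inter> full_shift k)"
    using D(3) by auto
  then have "emeasure \<mu> (K \<inter> full_shift k) \<le> emeasure \<mu> (\<Union>U\<in>D. U \<inter> full_shift k)"
    using null by (intro emeasure_mono) auto
  then show ?thesis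
    using null by auto
qed

lemma msupport_nonempty: "msupport k \<mu> \<noteq> {}"
proof
  assume "msupport k \<mu> = {}"
  then have "emeasure \<mu> (full_shift k) = 0"
    using null_if_disjoint_msupport[of UNIV] by simp
  then show False
    using prob_space.emeasure_space_1[OF invariant_measure_prob] by (simp add: invariant_measure_space)
qed

lemma compact_msupport: "compact (msupport k \<mu>)"
proof -
  have "msupport k \<mu> = full_shift k - \<Union>{U. open U \<and> emeasure \<mu> (U \<inter> full_shift k) = 0}"
    by (auto simp: msupport_def zero_less_iff_neq_zero)
  also have "compact \<dots>"
    by (intro compact_diff compact_full_shift) auto
  finally show ?thesis .
qed

lemma left_shift_msupport: "left_shift ` msupport k \<mu> = msupport k \<mu>"
proof (intro set_eqI iffI)
  fix x assume "x \<in> left_shift ` msupport k \<mu>"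
  then obtain \<omega> where \<omega>: "\<omega> \<in> msupport k \<mu>" and x: "x = left_shift \<omega>" by blast
  have "emeasure \<mu> (U \<inter> full_shift k) > 0" if U: "open U" "left_shift \<omega> \<in> U" for U
  proof -
    have "open (left_shift -` U)" using U(1) continuous_left_shift by (rule open_vimage)
    then show ?thesis
      using \<omega> U(2) emeasure_shift_vimage[OF U(1)] by (auto simp: msupport_def)
  qed
  then show "x \<in> msupport k \<mu>"
    using \<omega> x by (auto simp: msupport_def left_shift_full_shift)
next
  fix x assume x: "x \<in> msupport k \<mu>"
  have "emeasure \<mu> (U \<inter> full_shift k) > 0" if U: "open U" "right_shift x \<in> U" for U
  proof -
    have o: "open (right_shift -` U)" using U(1) continuous_right_shift by (rule open_vimage)
    have "left_shift -` (right_shift -` U) = U" by auto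
    then show ?thesis
      using x U(2) o emeasure_shift_vimage[OF o] by (auto simp: msupport_def)
  qed
  then have "right_shift x \<in> msupport k \<mu>"
    using x by (auto simp: msupport_def right_shift_full_shift)
  then show "x \<in> left_shift ` msupport k \<mu>"
    by (metis image_eqI right_shift_simps(2))
qed

end

section \<open>Periodic orbits, mixtures and cluster points of invariant measures\<close>

lemma invariant_measureI:
  assumes "prob_space \<mu>" "sets \<mu> = sets (restrict_space borel (full_shift k))"
    "distr \<mu> \<mu> left_shift = \<mu>"
  shows "\<mu> \<in> invariant_measures k"
  using assms by (auto simp: invariant_measures_def)

text \<open>The measure is uniform on the orbit, written as the image of the uniform distribution on
  \<open>{..<n}\<close>, where the shift becomes the cyclic rotation of the index. A lower bound for integrals
  is what a comparison with a supremum over all invariant measures asks for.\<close>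

lemma periodic_orbit_measure:
  assumes \<omega>: "\<omega> \<in> full_shift k" and n: "n \<ge> 1" and per: "(left_shift ^^ n) \<omega> = \<omega>"
  obtains \<mu> where "\<mu> \<in> invariant_measures k"
    "\<And>f c. locally_constant (f :: _ \<Rightarrow> real) \<Longrightarrow> (\<And>i. c \<le> f ((left_shift ^^ i) \<omega>)) \<Longrightarrow> c \<le> (\<integral>x. f x \<partial>\<mu>)"
proof -
  define R where "R = (restrict_space borel (full_shift k) :: (int \<Rightarrow> nat) measure)"
  define p where "p = pmf_of_set {..<n}"
  define g where "g i = (left_shift ^^ i) \<omega>" for i
  define s where "s i = (if Suc i = n then 0 else Suc i)" for i
  define \<mu> where "\<mu> = distr (measure_pmf p) R g"
  have p_set: "set_pmf p = {..<n}"
    using n unfolding p_def by (intro set_pmf_of_set) (auto simp: lessThan_empty_iff)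
  have g_sp: "g i \<in> full_shift k" for i
    unfolding g_def using \<omega> by (rule left_shift_funpow_full_shift)
  then have g_meas: "g \<in> measurable (measure_pmf p) R"
    by (auto simp: measurable_def R_def space_restrict_space)
  have sets: "sets \<mu> = sets R" by (simp add: \<mu>_def)
  have T: "left_shift \<in> measurable R R"
    by (rule left_shift_measurable) (simp add: R_def)
  have gs: "left_shift (g i) = g (s i)" for i
  proof (cases "Suc i = n")
    case True
    have "left_shift (g i) = (left_shift ^^ Suc i) \<omega>" by (simp add: g_def)
    then show ?thesis using True per by (simp add: g_def s_def del: funpow.simps)
  qed (simp add: g_def s_def)
  have "map_pmf s p = p"
  proof -
    have "inj_on s {..<n}" by (auto simp: inj_on_def s_def split: if_splits)
    moreover have "s ` {..<n} \<subseteq> {..<n}" using n by (auto simp: s_def)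
    ultimately have "s ` {..<n} = {..<n}" by (simp add: endo_inj_surj)
    then show ?thesis
      unfolding p_def using map_pmf_of_set_inj[OF \<open>inj_on s {..<n}\<close>] n by (simp add: lessThan_empty_iff)
  qed
  have inv: "distr \<mu> \<mu> left_shift = \<mu>"
  proof -
    have "distr \<mu> \<mu> left_shift = distr \<mu> R left_shift"
      by (rule distr_cong) (auto simp: sets)
    also have "\<dots> = distr (measure_pmf p) R (\<lambda>i. left_shift (g i))"
      unfolding \<mu>_def by (subst distr_distr[OF T g_meas]) (simp add: comp_def)
    also have "\<dots> = distr (distr (measure_pmf p) (count_space UNIV) s) R g"
      using g_sp by (subst distr_distr) (auto simp: comp_def gs measurable_def R_def space_restrict_space)
    also have "distr (measure_pmf p) (count_space UNIV) s = measure_pmf p"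
      using \<open>map_pmf s p = p\<close> by (metis map_pmf_rep_eq)
    finally show ?thesis by (simp add: \<mu>_def)
  qed
  have \<mu>: "\<mu> \<in> invariant_measures k"
  proof (rule invariant_measureI)
    show "prob_space \<mu>"
      unfolding \<mu>_def by (intro prob_space.prob_space_distr prob_space_measure_pmf g_meas)
  qed (use sets inv in \<open>auto simp: R_def\<close>)
  have int: "c \<le> (\<integral>x. f x \<partial>\<mu>)"
    if f: "locally_constant (f :: _ \<Rightarrow> real)" and c: "\<And>i. c \<le> f ((left_shift ^^ i) \<omega>)" for f c
  proof -
    have fm: "f \<in> borel_measurable R"
      using locally_constant_measurable[OF \<mu> f] measurable_cong_sets[OF sets refl] by blast
    have "integrable (measure_pmf p) (\<lambda>i. f (g i))"
      using locally_constant_integrable[OF \<mu> f] integrable_distr_eq[OF g_meas fm] by (simp add: \<mu>_def)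
    then have "c \<le> (\<integral>i. f (g i) \<partial>measure_pmf p)"
      using c by (intro measure_pmf.integral_ge_const) (auto simp: g_def)
    then show ?thesis
      unfolding \<mu>_def by (subst integral_distr[OF g_meas fm])
  qed
  show ?thesis by (rule that[OF \<mu> int])
qed

text \<open>Mixing with any weights that are all positive (here the geometric distribution) gives an invariant
  measure that charges every open set charged by some \<open>\<mu> i\<close> and inherits lower bounds common to all
  the integrals; the geometric average of these integrals is the integral for the mixture.\<close>

lemma countable_mixture:
  assumes \<mu>: "\<And>i::nat. \<mu> i \<in> invariant_measures k"
  obtains \<nu> where "\<nu> \<in> invariant_measures k"
    "\<And>U i. open U \<Longrightarrow> emeasure (\<mu> i) (U \<inter> full_shift k) > 0 \<Longrightarrow> emeasure \<nu> (U \<inter> full_shift k) > 0"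
    "\<And>f c. locally_constant (f :: _ \<Rightarrow> real) \<Longrightarrow> (\<And>i. c \<le> (\<integral>x. f x \<partial>\<mu> i)) \<Longrightarrow> c \<le> (\<integral>x. f x \<partial>\<nu>)"
proof -
  define R where "R = (restrict_space borel (full_shift k) :: (int \<Rightarrow> nat) measure)"
  define p where "p = measure_pmf (geometric_pmf (1/2))"
  interpret p: prob_space p
    unfolding p_def by (rule prob_space_measure_pmf)
  have sets_\<mu>: "sets (\<mu> i) = sets R" for i
    using invariant_measure_sets[OF \<mu>] by (simp add: R_def)
  have prob: "prob_space (\<mu> i)" for i
    by (rule invariant_measure_prob[OF \<mu>])
  have meas: "\<mu> \<in> measurable p (subprob_algebra R)"
    unfolding p_def
    using sets_\<mu> prob by (auto simp: measurable_def space_subprob_algebra prob_space_imp_subprob_space)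
  define \<nu> where "\<nu> = p \<bind> \<mu>"
  have ne: "space p \<noteq> {}" by (simp add: p_def)
  have sets_\<nu>: "sets \<nu> = sets R"
    unfolding \<nu>_def using sets_\<mu> ne by (intro sets_bind) auto
  have T: "left_shift \<in> measurable R R"
    by (rule left_shift_measurable) (simp add: R_def)
  have "distr \<nu> \<nu> left_shift = distr \<nu> R left_shift"
    by (rule distr_cong) (auto simp: sets_\<nu>)
  also have "\<dots> = p \<bind> (\<lambda>i. distr (\<mu> i) R left_shift)"
    unfolding \<nu>_def by (rule distr_bind[OF meas ne T])
  also have "(\<lambda>i. distr (\<mu> i) R left_shift) = \<mu>"
  proof
    fix i
    have "distr (\<mu> i) R left_shift = distr (\<mu> i) (\<mu> i) left_shift"
      by (rule distr_cong) (auto simp: sets_\<mu>)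
    then show "distr (\<mu> i) R left_shift = \<mu> i"
      using invariant_measure_distr[OF \<mu>] by simp
  qed
  finally have inv: "distr \<nu> \<nu> left_shift = \<nu>" by (simp add: \<nu>_def)
  have \<nu>: "\<nu> \<in> invariant_measures k"
  proof (rule invariant_measureI)
    show "prob_space \<nu>"
      unfolding \<nu>_def using prob by (intro p.prob_space_bind[OF _ meas]) auto
  qed (use sets_\<nu> inv in \<open>auto simp: R_def\<close>)
  have pos: "emeasure \<nu> (U \<inter> full_shift k) > 0"
    if U: "open U" and pos: "emeasure (\<mu> i) (U \<inter> full_shift k) > 0" for U i
  proof -
    have S: "U \<inter> full_shift k \<in> sets R"
      using invariant_measure_open[OF \<nu> U] sets_\<nu> by simp
    have "emeasure \<nu> (U \<inter> full_shift k) = (\<integral>\<^sup>+j. emeasure (\<mu> j) (U \<inter> full_shift k) \<partial>p)"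
      unfolding \<nu>_def by (rule emeasure_bind[OF ne meas S])
    also have "\<dots> \<noteq> 0"
    proof
      assume "(\<integral>\<^sup>+j. emeasure (\<mu> j) (U \<inter> full_shift k) \<partial>p) = 0"
      then have "AE j in p. emeasure (\<mu> j) (U \<inter> full_shift k) = 0"
        by (subst (asm) nn_integral_0_iff_AE) (auto simp: p_def)
      then have "\<forall>j\<in>set_pmf (geometric_pmf (1/2)). emeasure (\<mu> j) (U \<inter> full_shift k) = 0"
        unfolding p_def AE_measure_pmf_iff .
      moreover have "set_pmf (geometric_pmf (1/2)) = UNIV"
        by (rule set_pmf_geometric) auto
      ultimately have "emeasure (\<mu> i) (U \<inter> full_shift k) = 0"
        by blast
      with pos show False
        by simp
    qed
    finally show ?thesis by (simp add: zero_less_iff_neq_zero)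
  qed
  have int_ge: "c \<le> (\<integral>x. f x \<partial>\<nu>)"
    if f: "locally_constant (f :: _ \<Rightarrow> real)" and c: "\<And>i. c \<le> (\<integral>x. f x \<partial>\<mu> i)" for f c
  proof -
    have lev: "f -` {v} \<inter> full_shift k \<in> sets R" for v
      using f invariant_measure_open[OF \<nu>] sets_\<nu> by (auto simp: locally_constant_def)
    have int: "integrable p (\<lambda>i. measure (\<mu> i) S)" for S
      using prob by (intro p.integrable_const_bound[where B=1]) (auto simp: p_def prob_space.prob_le_1)
    have "c \<le> (\<integral>i. (\<integral>x. f x \<partial>\<mu> i) \<partial>p)"
    proof (rule p.integral_ge_const)
      show "integrable p (\<lambda>i. \<integral>x. f x \<partial>\<mu> i)"
        using int by (simp add: integral_locally_constant[OF \<mu> f])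
    qed (use c in auto)
    also have "\<dots> = (\<Sum>v\<in>f ` full_shift k. v * (\<integral>i. measure (\<mu> i) (f -` {v} \<inter> full_shift k) \<partial>p))"
      using int by (simp add: integral_locally_constant[OF \<mu> f])
    also have "\<dots> = (\<Sum>v\<in>f ` full_shift k. v * measure \<nu> (f -` {v} \<inter> full_shift k))"
      unfolding \<nu>_def by (simp add: p.measure_bind[OF meas lev])
    also have "\<dots> = (\<integral>x. f x \<partial>\<nu>)"
      by (rule integral_locally_constant[OF \<nu> f, symmetric])
    finally show ?thesis .
  qed
  show ?thesis by (rule that[OF \<nu> pos int_ge])
qed

text \<open>Traces are taken because \<open>full_shift k\<close> is a proper subset of the ambient type, which is not
  compact.\<close>

definition clopen_traces :: "nat \<Rightarrow> (int \<Rightarrow> nat) set set" where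
  "clopen_traces k = {S \<inter> full_shift k | S. open S \<and> closed S}"

lemma algebra_clopen_traces: "algebra (full_shift k) (clopen_traces k)"
  unfolding algebra_iff_Un
proof (intro conjI ballI)
  show "clopen_traces k \<subseteq> Pow (full_shift k)" "{} \<in> clopen_traces k"
    by (auto simp: clopen_traces_def)
  fix a assume a: "a \<in> clopen_traces k"
  then obtain S where S: "open S" "closed S" "a = S \<inter> full_shift k"
    by (auto simp: clopen_traces_def)
  then have "full_shift k - a = - S \<inter> full_shift k" "open (- S)" "closed (- S)"
    by auto
  then show "full_shift k - a \<in> clopen_traces k"
    unfolding clopen_traces_def by blast
  fix b assume "b \<in> clopen_traces k"
  then obtain S' where S': "open S'" "closed S'" "b = S' \<inter> full_shift k"
    by (auto simp: clopen_traces_def)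
  then have "a \<union> b = (S \<union> S') \<inter> full_shift k" "open (S \<union> S')" "closed (S \<union> S')"
    using S by auto
  then show "a \<union> b \<in> clopen_traces k"
    unfolding clopen_traces_def by blast
qed

lemma sigma_sets_clopen_traces:
  "sigma_sets (full_shift k) (clopen_traces k) = sets (restrict_space borel (full_shift k))"
proof
  have "clopen_traces k \<subseteq> sets (restrict_space borel (full_shift k))"
  proof
    fix C assume "C \<in> clopen_traces k"
    then obtain S where "open S" "C = full_shift k \<inter> S"
      unfolding clopen_traces_def by blast
    then show "C \<in> sets (restrict_space borel (full_shift k))"
      unfolding sets_restrict_space by (intro image_eqI[of _ _ S]) auto
  qed
  then show "sigma_sets (full_shift k) (clopen_traces k) \<subseteq> sets (restrict_space borel (full_shift k))"
    using sets.sigma_sets_subset[of _ "restrict_space borel (full_shift k)"]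
    by (simp add: space_restrict_space)
next
  let ?E = "{{f \<in> \<Pi>\<^sub>E i\<in>UNIV. UNIV. f i \<in> A} | (i::int) A. i \<in> UNIV \<and> A \<in> sets (borel :: nat measure)}"
  have borel: "sets (borel :: (int \<Rightarrow> nat) measure) = sigma_sets UNIV ?E"
    using sets_PiM_single[of "UNIV :: int set" "\<lambda>_. borel :: nat measure"]
    by (simp add: sets_PiM_equal_borel PiE_def)
  have X: "full_shift k \<in> sigma_sets UNIV ?E"
    unfolding borel[symmetric] using closed_full_shift by simp
  have "sets (restrict_space borel (full_shift k)) = (\<inter>) (full_shift k) ` sigma_sets UNIV ?E"
    by (simp add: sets_restrict_space borel)
  also have "\<dots> = sigma_sets (full_shift k) ((\<inter>) (full_shift k) ` ?E)"
    by (rule sigma_sets_Int[OF X]) auto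
  also have "\<dots> \<subseteq> sigma_sets (full_shift k) (clopen_traces k)"
  proof (rule sigma_sets_mono')
    show "(\<inter>) (full_shift k) ` ?E \<subseteq> clopen_traces k"
    proof
      fix C assume "C \<in> (\<inter>) (full_shift k) ` ?E"
      then obtain i :: int and A where C: "C = (\<lambda>f. f i) -` A \<inter> full_shift k"
        by auto
      have "locally_constant (\<lambda>f :: int \<Rightarrow> nat. f i)"
        by (rule locally_constantI_cylinder[of "{i}"]) auto
      then have "open ((\<lambda>f. f i) -` A)" "open ((\<lambda>f. f i) -` (- A))"
        unfolding locally_constant_def by auto
      then show "C \<in> clopen_traces k"
        unfolding clopen_traces_def C by (auto simp: closed_def vimage_Compl)
    qed
  qed
  finally show "sets (restrict_space borel (full_shift k)) \<subseteq> sigma_sets (full_shift k) (clopen_traces k)" .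
qed

text \<open>An uncountable product of compact spaces need not be sequentially compact, hence a filter finer
  than \<open>sequentially\<close> in place of a subsequence.\<close>

lemma compact_cluster_filter:
  assumes "compact K" "\<And>j::nat. p j \<in> K"
  obtains m F where "m \<in> K" "F \<noteq> bot" "F \<le> sequentially" "filterlim p (nhds m) F"
proof -
  have "filtermap p sequentially \<noteq> bot"
    by (simp add: filtermap_bot_iff)
  then obtain m where m: "m \<in> K" "inf (nhds m) (filtermap p sequentially) \<noteq> bot"
    using assms unfolding compact_filter by (auto simp: eventually_filtermap)
  define F where "F = inf sequentially (filtercomap p (nhds m))"
  have nonbot: "F \<noteq> bot"
  proof
    assume "F = bot"
    then have "eventually (\<lambda>_. False) F" by simp
    then obtain Q R R' where Q: "eventually Q sequentially" and R': "eventually R' (nhds m)"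
      and no: "\<And>j. R' (p j) \<Longrightarrow> R j" "\<And>j. Q j \<Longrightarrow> R j \<Longrightarrow> False"
      unfolding F_def eventually_inf eventually_filtercomap by metis
    have "eventually (\<lambda>y. \<not> R' y) (filtermap p sequentially)"
      unfolding eventually_filtermap using Q by eventually_elim (use no in blast)
    then have "eventually (\<lambda>_. False) (inf (nhds m) (filtermap p sequentially))"
      unfolding eventually_inf using R' by blast
    then show False using m(2) by (simp add: eventually_False)
  qed
  have le: "F \<le> sequentially"
    unfolding F_def by (rule inf_le1)
  have lim: "filterlim p (nhds m) F"
    unfolding F_def by (rule filterlim_mono[OF filterlim_filtercomap order_refl inf_le2])
  show ?thesis
    by (rule that[OF m(1) nonbot le lim])
qed

text \<open>Weak compactness of the set of invariant measures. As functions of a set, probability measures are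
  points of a product of copies of \<open>{0..1}\<close>, which is compact by Tychonoff's theorem. A cluster
  point \<open>m\<close> of the sequence is finitely additive and invariant on clopen sets, since these
  properties are equations between coordinates, and the Caratheodory extension of \<open>m\<close> is the limit.\<close>

lemma invariant_measures_cluster:
  assumes \<mu>: "\<And>j::nat. \<mu> j \<in> invariant_measures k"
  obtains \<nu> F where "\<nu> \<in> invariant_measures k" "F \<noteq> bot" "F \<le> sequentially"
    "\<And>f. locally_constant (f :: _ \<Rightarrow> real) \<Longrightarrow> ((\<lambda>j. \<integral>x. f x \<partial>\<mu> j) \<longlongrightarrow> (\<integral>x. f x \<partial>\<nu>)) F"
proof -
  let ?X = "full_shift k" and ?G = "clopen_traces k"
  interpret G: algebra ?X ?G by (rule algebra_clopen_traces)
  have prob: "prob_space (\<mu> j)" for j by (rule invariant_measure_prob[OF \<mu>])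
  have "compact (PiE UNIV (\<lambda>_ :: (int \<Rightarrow> nat) set. {0..1::real}))"
    by (rule compact_PiE_UNIV) simp
  then obtain m F where m: "m \<in> PiE UNIV (\<lambda>_. {0..1::real})" and F: "F \<noteq> bot" "F \<le> sequentially"
    and lim: "filterlim (\<lambda>j. measure (\<mu> j)) (nhds m) F"
    by (rule compact_cluster_filter[of _ "\<lambda>j. measure (\<mu> j)"])
      (simp add: PiE_def prob_space.prob_le_1[OF prob])
  have m_lim: "((\<lambda>j. measure (\<mu> j) C) \<longlongrightarrow> m C) F" for C
  proof (rule topological_tendstoI)
    fix S :: "real set" assume "open S" "m C \<in> S"
    then have "open ((\<lambda>x. x C) -` S)" "m \<in> (\<lambda>x. x C) -` S"
      by (auto intro: open_vimage)
    from topological_tendstoD[OF lim this] show "\<forall>\<^sub>F j in F. measure (\<mu> j) C \<in> S"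
      by simp
  qed
  have m_nonneg: "0 \<le> m C" for C
    using m by (auto simp: PiE_def)
  have G_open: "\<exists>S. open S \<and> C = S \<inter> ?X" if "C \<in> ?G" for C
    using that unfolding clopen_traces_def by blast
  have G_sets: "C \<in> sets (\<mu> j)" if "C \<in> ?G" for C j
  proof -
    obtain S where "open S" "C = S \<inter> ?X" using G_open[OF \<open>C \<in> ?G\<close>] by blast
    then show ?thesis using invariant_measure_open[OF \<mu>] by simp
  qed
  have m_empty: "m {} = 0"
    using tendsto_unique[OF F(1) m_lim[of "{}"]] by simp
  have m_space: "m ?X = 1"
  proof -
    have "measure (\<mu> j) ?X = 1" for j
      using prob_space.prob_space[OF prob, of j] by (simp add: invariant_measure_space[OF \<mu>])
    then show ?thesis
      using tendsto_unique[OF F(1) m_lim[of ?X]] by simp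
  qed
  have m_add: "m (C \<union> D) = m C + m D" if "C \<in> ?G" "D \<in> ?G" "C \<inter> D = {}" for C D
  proof -
    have "measure (\<mu> j) (C \<union> D) = measure (\<mu> j) C + measure (\<mu> j) D" for j
    proof -
      interpret prob_space "\<mu> j" by (rule prob)
      show ?thesis using that G_sets by (intro finite_measure_Union) auto
    qed
    then show ?thesis
      using tendsto_unique[OF F(1) m_lim[of "C \<union> D"]] tendsto_add[OF m_lim[of C] m_lim[of D]] by simp
  qed
  have m_inv: "m (left_shift -` C \<inter> ?X) = m C" if C: "C \<in> ?G" for C
  proof -
    obtain S where S: "open S" "C = S \<inter> ?X" using G_open[OF C] by blast
    have "left_shift -` C \<inter> ?X = left_shift -` S \<inter> ?X"
      using S(2) left_shift_full_shift by blast
    then have "measure (\<mu> j) (left_shift -` C \<inter> ?X) = measure (\<mu> j) C" for j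
      using emeasure_shift_vimage[OF \<mu> S(1)] S(2) by (simp add: measure_def)
    then show ?thesis
      using tendsto_unique[OF F(1) m_lim[of "left_shift -` C \<inter> ?X"]] m_lim[of C] by simp
  qed
  have G_shift: "left_shift -` C \<inter> ?X \<in> ?G" if C: "C \<in> ?G" for C
  proof -
    obtain S where S: "open S" "closed S" "C = S \<inter> ?X" using C unfolding clopen_traces_def by blast
    have "left_shift -` C \<inter> ?X = left_shift -` S \<inter> ?X"
      using S(3) left_shift_full_shift by blast
    moreover have "open (left_shift -` S)" "closed (left_shift -` S)"
      using S continuous_left_shift by (auto intro: open_vimage closed_vimage)
    ultimately show ?thesis unfolding clopen_traces_def by blast
  qed
  \<comment> \<open>Members of the algebra are compact, so decreasing sequences with empty intersection
    are eventually empty and countable additivity comes for free.\<close>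
  have "\<exists>\<mu>'. (\<forall>C\<in>?G. \<mu>' C = ennreal (m C)) \<and> measure_space ?X (sigma_sets ?X ?G) \<mu>'"
  proof (rule G.caratheodory_empty_continuous)
    show "positive ?G (\<lambda>C. ennreal (m C))" by (simp add: positive_def m_empty)
    show "additive ?G (\<lambda>C. ennreal (m C))"
      using m_add m_nonneg by (auto simp: additive_def ennreal_plus)
    fix A :: "nat \<Rightarrow> (int \<Rightarrow> nat) set"
    assume A: "range A \<subseteq> ?G" "decseq A" "(\<Inter>i. A i) = {}"
    have closed: "closed (A i)" for i
    proof -
      have "A i \<in> ?G" using A(1) by blast
      then obtain S where "closed S" "A i = S \<inter> ?X"
        unfolding clopen_traces_def by blast
      then show ?thesis using closed_full_shift by (simp add: closed_Int)
    qed
    have "\<exists>N. A N = {}"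
    proof (rule ccontr)
      assume ne: "\<nexists>N. A N = {}"
      have "?X \<inter> (\<Inter>i\<in>UNIV. A i) \<noteq> {}"
      proof (rule compact_imp_fip_image[OF compact_full_shift closed])
        fix I :: "nat set" assume "finite I"
        then obtain n where "\<And>i. i \<in> I \<Longrightarrow> i \<le> n"
          using finite_nat_set_iff_bounded_le by auto
        then have "A n \<subseteq> (\<Inter>i\<in>I. A i)"
          using A(2) unfolding decseq_def by blast
        moreover have "A n \<subseteq> ?X"
          using A(1) unfolding clopen_traces_def by blast
        ultimately show "?X \<inter> (\<Inter>i\<in>I. A i) \<noteq> {}"
          using ne by blast
      qed
      then show False using A(3) by blast
    qed
    then obtain N where N: "A N = {}" by blast
    have "\<forall>\<^sub>F i in sequentially. ennreal (m (A i)) = 0"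
    proof (rule eventually_sequentiallyI[of N])
      fix i assume "N \<le> i"
      then have "A i = {}" using N A(2) unfolding decseq_def by blast
      then show "ennreal (m (A i)) = 0" by (simp add: m_empty)
    qed
    then show "(\<lambda>i. ennreal (m (A i))) \<longlonglongrightarrow> 0" by (rule tendsto_eventually)
  qed simp
  then obtain \<mu>' where \<mu>': "\<And>C. C \<in> ?G \<Longrightarrow> \<mu>' C = ennreal (m C)"
    and ms: "measure_space ?X (sigma_sets ?X ?G) \<mu>'" by blast
  define \<nu> where "\<nu> = measure_of ?X (sigma_sets ?X ?G) \<mu>'"
  have G_Pow: "?G \<subseteq> Pow ?X" unfolding clopen_traces_def by blast
  have sp: "space \<nu> = ?X"
    unfolding \<nu>_def using sigma_sets_into_sp[OF G_Pow] by (intro space_measure_of) auto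
  have sets_G: "sets \<nu> = sigma_sets ?X ?G"
    unfolding \<nu>_def using ms by (intro sigma_algebra.sets_measure_of_eq) (auto simp: measure_space_def)
  then have sets: "sets \<nu> = sets (restrict_space borel ?X)"
    by (simp add: sigma_sets_clopen_traces)
  have em: "emeasure \<nu> C = ennreal (m C)" if "C \<in> ?G" for C
    unfolding \<nu>_def using ms that \<mu>'[OF that]
    by (subst emeasure_measure_of_sigma) (auto simp: measure_space_def)
  have T: "left_shift \<in> measurable \<nu> \<nu>"
    by (rule left_shift_measurable[OF sets])
  have X_G: "?X \<in> ?G"
    using G.top .
  have inv: "distr \<nu> \<nu> left_shift = \<nu>"
  proof (rule measure_eqI_generator_eq[where E="?G" and \<Omega>="?X" and A="\<lambda>_. ?X"])
    show "Int_stable ?G"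
      using G.Int by (auto simp: Int_stable_def)
    show "emeasure (distr \<nu> \<nu> left_shift) C = emeasure \<nu> C" if C: "C \<in> ?G" for C
    proof -
      have "emeasure (distr \<nu> \<nu> left_shift) C = emeasure \<nu> (left_shift -` C \<inter> ?X)"
        using C sets_G by (subst emeasure_distr[OF T]) (auto simp: sp)
      then show ?thesis using em[OF C] em[OF G_shift[OF C]] m_inv[OF C] by simp
    qed
    show "emeasure (distr \<nu> \<nu> left_shift) ?X \<noteq> \<infinity>" for i :: nat
    proof -
      have "?X \<in> sets \<nu>" using sp sets.top by metis
      moreover have "left_shift -` ?X \<inter> space \<nu> = ?X"
        using left_shift_full_shift sp by blast
      ultimately show ?thesis
        using em[OF X_G] by (simp add: emeasure_distr[OF T])
    qed
  qed (use G_Pow sets_G X_G in auto)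
  have \<nu>: "\<nu> \<in> invariant_measures k"
  proof (rule invariant_measureI[OF _ sets inv])
    show "prob_space \<nu>"
      using em[OF X_G] m_space by (intro prob_spaceI) (simp add: sp)
  qed
  have conv: "((\<lambda>j. \<integral>x. f x \<partial>\<mu> j) \<longlongrightarrow> (\<integral>x. f x \<partial>\<nu>)) F" if f: "locally_constant (f :: _ \<Rightarrow> real)" for f
  proof -
    have "measure \<nu> (f -` {v} \<inter> ?X) = m (f -` {v} \<inter> ?X)" for v
    proof -
      have "open (f -` {v})" "open (f -` (- {v}))"
        using f unfolding locally_constant_def by auto
      then have "f -` {v} \<inter> ?X \<in> ?G"
        unfolding clopen_traces_def by (intro CollectI exI[of _ "f -` {v}"]) (simp add: closed_def vimage_Compl)
      then show ?thesis using em m_nonneg by (simp add: measure_def)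
    qed
    then show ?thesis
      unfolding integral_locally_constant[OF \<mu> f] integral_locally_constant[OF \<nu> f]
      by (auto intro!: tendsto_intros m_lim)
  qed
  show ?thesis by (rule that[OF \<nu> F conv])
qed

section \<open>Maximizing measures of almost additive potentials\<close>

text \<open>A function of words of length \<open>n\<close>, for each \<open>n\<close>, that is additive under concatenation up to \<open>C\<close>.
  The last assumption says that \<open>lam \<mu>\<close> is the growth rate of the integrals, with the same error.\<close>

locale almost_additive_potential =
  fixes k :: nat and a :: "nat \<Rightarrow> (int \<Rightarrow> nat) \<Rightarrow> real" and C :: real
    and lam :: "(int \<Rightarrow> nat) measure \<Rightarrow> real"
  assumes k_pos: "k \<ge> 1"
    and a_word: "\<And>n \<omega> \<omega>'. (\<And>i. i < n \<Longrightarrow> \<omega> (int i) = \<omega>' (int i)) \<Longrightarrow> a n \<omega> = a n \<omega>'"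
    and a_add: "\<And>n m \<omega>. \<omega> \<in> full_shift k \<Longrightarrow>
      \<bar>a (n + m) \<omega> - a n \<omega> - a m ((left_shift ^^ n) \<omega>)\<bar> \<le> C"
    and lam_approx: "\<And>\<mu> n. \<mu> \<in> invariant_measures k \<Longrightarrow> \<bar>(\<integral>\<omega>. a n \<omega> \<partial>\<mu>) - real n * lam \<mu>\<bar> \<le> C"
begin

definition top_rate :: real where
  "top_rate = (SUP \<mu>\<in>invariant_measures k. lam \<mu>)"

definition maximizing_set :: "(int \<Rightarrow> nat) set" where
  "maximizing_set = (\<Union>\<mu>\<in>{\<mu> \<in> invariant_measures k. lam \<mu> = top_rate}. msupport k \<mu>)"

lemma locally_constant_a: "locally_constant (a n)"
  by (rule locally_constantI_cylinder[of "int ` {..<n}"]) (auto intro: a_word)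

lemma ones_in_full_shift: "(\<lambda>_. 1) \<in> full_shift k"
  using k_pos by (auto simp: full_shift_def)

lemma C_nonneg: "0 \<le> C"
  using a_add[OF ones_in_full_shift, of 0 0] by linarith

lemma a_0_le: "\<omega> \<in> full_shift k \<Longrightarrow> a 0 \<omega> \<le> C"
  using a_add[of \<omega> 0 0] by simp

lemma invariant_measures_nonempty: "invariant_measures k \<noteq> {}"
proof -
  have "(left_shift ^^ 1) (\<lambda>_. 1) = (\<lambda>_. 1)" by (simp add: left_shift_def)
  then show ?thesis
    using periodic_orbit_measure[OF ones_in_full_shift, of 1] by (metis empty_iff order_refl)
qed

lemma lam_bdd_above: "bdd_above (lam ` invariant_measures k)"
proof (rule bdd_aboveI2)
  fix \<mu> assume \<mu>: "\<mu> \<in> invariant_measures k"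
  interpret prob_space \<mu> by (rule invariant_measure_prob[OF \<mu>])
  have fin: "finite (a 1 ` full_shift k)"
    by (rule locally_constant_finite_image[OF locally_constant_a compact_full_shift])
  have "(\<integral>\<omega>. a 1 \<omega> \<partial>\<mu>) \<le> Max (a 1 ` full_shift k)"
    using fin locally_constant_integrable[OF \<mu> locally_constant_a]
    by (intro integral_le_const AE_I2) (auto simp: invariant_measure_space[OF \<mu>])
  then show "lam \<mu> \<le> Max (a 1 ` full_shift k) + C"
    using lam_approx[OF \<mu>, of 1] by simp
qed

lemma lam_le_top_rate: "\<mu> \<in> invariant_measures k \<Longrightarrow> lam \<mu> \<le> top_rate"
  unfolding top_rate_def using lam_bdd_above by (intro cSUP_upper)

text \<open>The deficit \<open>D\<close> is independent of \<open>n\<close>, so it disappears in the growth rate.\<close>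

lemma lam_eq_top_rateI:
  assumes \<mu>: "\<mu> \<in> invariant_measures k"
    and ge: "\<And>n. real n * top_rate - D \<le> (\<integral>\<omega>. a n \<omega> \<partial>\<mu>)"
  shows "lam \<mu> = top_rate"
proof (rule antisym[OF lam_le_top_rate[OF \<mu>]], rule ccontr)
  assume "\<not> top_rate \<le> lam \<mu>"
  then have "top_rate - lam \<mu> > 0" by simp
  then obtain n :: nat where "real n * (top_rate - lam \<mu>) > C + D"
    using reals_Archimedean3 by blast
  then show False
    using ge[of n] lam_approx[OF \<mu>, of n] by (simp add: algebra_simps abs_le_iff)
qed

text \<open>Repeat the first \<open>n\<close> letters of \<open>\<omega>\<close> periodically. Along the periodic orbit \<open>a n\<close> differs from
  \<open>a n \<omega>\<close> by at most \<open>2 * C\<close>, because \<open>a (n + i)\<close> can be split at \<open>i\<close> or at \<open>n\<close>; so if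
  \<open>a n \<omega>\<close> were larger, the orbit measure would have a rate above the supremum.\<close>

lemma a_le_top_rate:
  assumes \<omega>: "\<omega> \<in> full_shift k"
  shows "a n \<omega> \<le> real n * top_rate + 3 * C"
proof (cases "n = 0")
  case True
  then show ?thesis using a_0_le[OF \<omega>] C_nonneg by simp
next
  case False
  then have n: "n \<ge> 1" by simp
  define \<theta> where "\<theta> i = \<omega> (i mod int n)" for i
  have \<theta>: "\<theta> \<in> full_shift k"
    using \<omega> by (auto simp: \<theta>_def full_shift_def)
  have per: "(left_shift ^^ n) \<theta> = \<theta>"
    by (auto simp: left_shift_funpow \<theta>_def)
  have word: "a n \<omega> = a n \<theta>"
    by (rule a_word) (simp add: \<theta>_def)
  \<comment> \<open>Both splittings of \<open>a (n + i) \<theta>\<close> contain the term \<open>a i \<theta>\<close>, by periodicity.\<close>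
  have shift: "a n \<omega> - 2 * C \<le> a n ((left_shift ^^ i) \<theta>)" for i
    using a_add[OF \<theta>, of n i] a_add[OF \<theta>, of i n] word per by (simp add: add.commute abs_le_iff)
  obtain \<mu> where \<mu>: "\<mu> \<in> invariant_measures k"
    and int: "\<And>f c. locally_constant (f :: _ \<Rightarrow> real) \<Longrightarrow>
      (\<And>i. c \<le> f ((left_shift ^^ i) \<theta>)) \<Longrightarrow> c \<le> (\<integral>x. f x \<partial>\<mu>)"
    by (rule periodic_orbit_measure[OF \<theta> n per]) blast
  have "a n \<omega> - 2 * C \<le> (\<integral>x. a n x \<partial>\<mu>)"
    by (rule int[OF locally_constant_a shift])
  moreover have "real n * lam \<mu> \<le> real n * top_rate"
    using lam_le_top_rate[OF \<mu>] by (simp add: mult_left_mono)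
  ultimately show ?thesis
    using lam_approx[OF \<mu>, of n] by (simp add: abs_le_iff)
qed

text \<open>A cluster point of a maximizing sequence maximizes, since \<open>lam\<close> is a uniform limit of integrals of
  locally constant functions.\<close>

lemma maximizing_measure_exists:
  obtains \<mu> where "\<mu> \<in> invariant_measures k" "lam \<mu> = top_rate"
proof -
  have "\<exists>\<mu>\<in>invariant_measures k. top_rate - 1 / real (Suc j) < lam \<mu>" for j
    using less_cSUP_iff[OF invariant_measures_nonempty lam_bdd_above, of "top_rate - 1 / real (Suc j)"]
    unfolding top_rate_def by simp
  then obtain \<mu> where \<mu>: "\<And>j. \<mu> j \<in> invariant_measures k"
    and near: "\<And>j. top_rate - 1 / real (Suc j) < lam (\<mu> j)"
    by metis
  obtain \<nu> F where \<nu>: "\<nu> \<in> invariant_measures k" and F: "F \<noteq> bot" "F \<le> sequentially"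
    and lim: "\<And>f. locally_constant (f :: _ \<Rightarrow> real) \<Longrightarrow> ((\<lambda>j. \<integral>x. f x \<partial>\<mu> j) \<longlongrightarrow> (\<integral>x. f x \<partial>\<nu>)) F"
    by (rule invariant_measures_cluster[of \<mu> k, OF \<mu>]) blast
  have "real n * top_rate - C \<le> (\<integral>\<omega>. a n \<omega> \<partial>\<nu>)" for n
  proof (rule tendsto_le[OF F(1) lim[OF locally_constant_a]])
    have "(\<lambda>j. real n * (top_rate - 1 / real (Suc j)) - C) \<longlonglongrightarrow> real n * (top_rate - 0) - C"
      by (intro tendsto_intros LIMSEQ_Suc[OF lim_const_over_n])
    then show "((\<lambda>j. real n * (top_rate - 1 / real (Suc j)) - C) \<longlongrightarrow> real n * top_rate - C) F"
      using tendsto_mono[OF F(2)] by simp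
    have "real n * (top_rate - 1 / real (Suc j)) - C \<le> (\<integral>\<omega>. a n \<omega> \<partial>\<mu> j)" for j
      using lam_approx[OF \<mu>, of j n] mult_left_mono[OF less_imp_le[OF near[of j]], of "real n"]
      by (simp add: abs_le_iff)
    then show "\<forall>\<^sub>F j in F. real n * (top_rate - 1 / real (Suc j)) - C \<le> (\<integral>\<omega>. a n \<omega> \<partial>\<mu> j)"
      by simp
  qed
  then have "lam \<nu> = top_rate"
    by (rule lam_eq_top_rateI[OF \<nu>])
  then show ?thesis by (rule that[OF \<nu>])
qed

text \<open>The constant is what the counting below consumes: appending a deficient block to an orbit segment
  and continuing past it costs \<open>C\<close> at each of the two junctions, and the continuation may exceed its
  mean by \<open>3 * C\<close>; the last unit is a net loss.\<close>

definition deficient :: "nat \<Rightarrow> (int \<Rightarrow> nat) set" where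
  "deficient n = {\<omega>. a n \<omega> < real n * top_rate - (5 * C + 1)}"

text \<open>Cut the orbit segment at the last visit to the deficient set. The part before it is covered by
  induction, the visit loses a unit more than the errors can make up, and the part after it obeys the
  general upper bound.\<close>

lemma visits_to_deficient:
  assumes \<omega>: "\<omega> \<in> full_shift k"
  shows "a (j * n) \<omega> \<le> real (j * n) * top_rate + 3 * C
    - (\<Sum>i<j. indicator (deficient n) ((left_shift ^^ (i * n)) \<omega>))"
proof (induction j rule: less_induct)
  case (less j)
  define v where "v i = (indicator (deficient n) ((left_shift ^^ (i * n)) \<omega>) :: real)" for i
  show ?case
  proof (cases "\<exists>i<j. v i \<noteq> 0")
    case False
    then have "(\<Sum>i<j. v i) = 0" by (intro sum.neutral) auto
    then show ?thesis
      using a_le_top_rate[OF \<omega>, of "j * n"] by (simp add: v_def)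
  next
    case True
    define i where "i = Max {i. i < j \<and> v i \<noteq> 0}"
    have "i \<in> {i. i < j \<and> v i \<noteq> 0}"
      unfolding i_def using True by (intro Max_in) auto
    then have i: "i < j" "v i \<noteq> 0" by auto
    have last: "v i' = 0" if "i < i'" "i' < j" for i'
      using Max_ge[of "{i. i < j \<and> v i \<noteq> 0}" i'] that unfolding i_def by fastforce
    have vi: "v i = 1" using i(2) by (simp add: v_def indicator_def split: if_splits)
    have "(\<Sum>i<j. v i) = (\<Sum>i<Suc i. v i)"
      by (rule sum.mono_neutral_right) (use i last in \<open>auto simp: less_Suc_eq_le not_le\<close>)
    then have cnt: "(\<Sum>i<j. v i) = (\<Sum>i<i. v i) + 1" by (simp add: vi)
    define r where "r = (j - Suc i) * n"
    let ?\<omega>1 = "(left_shift ^^ (i * n)) \<omega>"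
    have \<omega>1: "?\<omega>1 \<in> full_shift k" by (rule left_shift_funpow_full_shift[OF \<omega>])
    have jn: "j * n = i * n + (n + r)"
    proof -
      obtain d where "j = Suc i + d" using i(1) less_imp_Suc_add by auto
      then show ?thesis by (simp add: r_def algebra_simps)
    qed
    have "?\<omega>1 \<in> deficient n" using vi by (simp add: v_def indicator_def split: if_splits)
    then have "a n ?\<omega>1 < real n * top_rate - (5 * C + 1)" by (simp add: deficient_def)
    moreover have "a (j * n) \<omega> \<le> a (i * n) \<omega> + a (n + r) ?\<omega>1 + C"
      using a_add[OF \<omega>, of "i * n" "n + r"] unfolding jn by (simp add: abs_le_iff)
    moreover have "a (n + r) ?\<omega>1 \<le> a n ?\<omega>1 + a r ((left_shift ^^ n) ?\<omega>1) + C"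
      using a_add[OF \<omega>1, of n r] by (simp add: abs_le_iff)
    moreover have "a r ((left_shift ^^ n) ?\<omega>1) \<le> real r * top_rate + 3 * C"
      by (rule a_le_top_rate[OF left_shift_funpow_full_shift[OF \<omega>1]])
    moreover have "a (i * n) \<omega> \<le> real (i * n) * top_rate + 3 * C - (\<Sum>i<i. v i)"
      using less.IH[OF i(1)] by (simp add: v_def)
    moreover have "real (j * n) * top_rate
        = real (i * n) * top_rate + real n * top_rate + real r * top_rate"
      unfolding jn by (simp add: algebra_simps)
    ultimately have "a (j * n) \<omega> \<le> real (j * n) * top_rate + 3 * C - (\<Sum>i<j. v i)"
      unfolding cnt by linarith
    then show ?thesis by (simp add: v_def)
  qed
qed

text \<open>If a maximizing measure charged the deficient set, the expected number of visits would grow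
  linearly in \<open>j\<close>, and with it the gap between the integral of \<open>a (j * n)\<close> and
  \<open>j * n * top_rate\<close>; but that gap is at most \<open>C\<close>.\<close>

lemma deficient_null:
  assumes \<mu>: "\<mu> \<in> invariant_measures k" and max: "lam \<mu> = top_rate"
  shows "emeasure \<mu> (deficient n \<inter> full_shift k) = 0"
proof -
  interpret prob_space \<mu> by (rule invariant_measure_prob[OF \<mu>])
  let ?E = "deficient n"
  have "?E = a n -` {..<real n * top_rate - (5 * C + 1)}"
    by (auto simp: deficient_def)
  then have ind: "indicator ?E = (\<lambda>\<omega>. indicator {..<real n * top_rate - (5 * C + 1)} (a n \<omega>) :: real)"
    by (auto simp: indicator_def)
  have lc: "locally_constant (indicator ?E :: _ \<Rightarrow> real)"
    unfolding ind by (rule locally_constant_compose[OF locally_constant_a])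
  have "open ?E"
    using locally_constant_a \<open>?E = a n -` _\<close> by (simp add: locally_constant_def)
  then have E_sets: "?E \<inter> full_shift k \<in> sets \<mu>"
    by (rule invariant_measure_open[OF \<mu>])
  define p where "p = measure \<mu> (?E \<inter> full_shift k)"
  have visit: "(\<integral>\<omega>. indicator ?E ((left_shift ^^ m) \<omega>) \<partial>\<mu>) = p" for m
  proof -
    have "(\<integral>\<omega>. indicator ?E ((left_shift ^^ m) \<omega>) \<partial>\<mu>) = (\<integral>\<omega>. (indicator ?E \<omega> :: real) \<partial>\<mu>)"
      by (rule integral_measure_preserving[where g="indicator ?E", OF invariant_measure_meas[OF \<mu>]
            invariant_measure_distr[OF \<mu>] locally_constant_measurable[OF \<mu> lc]])
    also have "\<dots> = (\<integral>\<omega>. indicator (?E \<inter> full_shift k) \<omega> \<partial>\<mu>)"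
      by (intro Bochner_Integration.integral_cong) (auto simp: invariant_measure_space[OF \<mu>] indicator_def)
    also have "\<dots> = p"
      using E_sets by (simp add: p_def)
    finally show ?thesis .
  qed
  have visit_int: "integrable \<mu> (\<lambda>\<omega>. indicator ?E ((left_shift ^^ m) \<omega>) :: real)" for m
    using measurable_compose[OF measure_preserving_funpow(1)[OF invariant_measure_meas[OF \<mu>]
        invariant_measure_distr[OF \<mu>]] locally_constant_measurable[OF \<mu> lc]]
    by (intro integrable_const_bound[where B=1]) (auto simp: indicator_def)
  have "real j * p \<le> 4 * C" for j
  proof -
    have "(\<integral>\<omega>. a (j * n) \<omega> \<partial>\<mu>) \<le> (\<integral>\<omega>. real (j * n) * top_rate + 3 * C
        - (\<Sum>i<j. indicator ?E ((left_shift ^^ (i * n)) \<omega>)) \<partial>\<mu>)"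
      using visits_to_deficient visit_int
      by (intro integral_mono locally_constant_integrable[OF \<mu> locally_constant_a]
          Bochner_Integration.integrable_diff Bochner_Integration.integrable_sum)
        (auto simp: invariant_measure_space[OF \<mu>])
    also have "\<dots> = real (j * n) * top_rate + 3 * C - real j * p"
      using visit_int by (simp add: visit prob_space)
    finally show ?thesis
      using lam_approx[OF \<mu>, of "j * n"] max by (simp add: abs_le_iff)
  qed
  moreover have "0 \<le> p" by (simp add: p_def)
  ultimately have "p = 0"
    using reals_Archimedean3[of p] by (metis less_le not_le)
  then show ?thesis
    by (simp add: p_def emeasure_eq_measure)
qed

text \<open>Deficient sets are open and null for maximizing measures, so they miss all their supports, hence
  also the support of \<open>\<nu>\<close>. Thus \<open>a n\<close> is \<open>\<nu>\<close>-almost surely at least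
  \<open>n * top_rate\<close> up to a constant that does not depend on \<open>n\<close>.\<close>

lemma lam_eq_top_rate_if_msupport_subset:
  assumes \<nu>: "\<nu> \<in> invariant_measures k" and sub: "msupport k \<nu> \<subseteq> maximizing_set"
  shows "lam \<nu> = top_rate"
proof (rule lam_eq_top_rateI[OF \<nu>])
  fix n
  interpret prob_space \<nu> by (rule invariant_measure_prob[OF \<nu>])
  let ?E = "deficient n"
  have pre: "?E = a n -` {..<real n * top_rate - (5 * C + 1)}"
    "- ?E = a n -` {real n * top_rate - (5 * C + 1)..}"
    by (auto simp: deficient_def)
  have E: "open ?E" "closed ?E"
    unfolding closed_def pre(2) using locally_constant_a[of n] pre(1) by (simp_all add: locally_constant_def)
  have "?E \<inter> maximizing_set = {}"
  proof (rule ccontr)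
    assume "?E \<inter> maximizing_set \<noteq> {}"
    then obtain x \<mu> where "x \<in> ?E" "\<mu> \<in> invariant_measures k" "lam \<mu> = top_rate" "x \<in> msupport k \<mu>"
      unfolding maximizing_set_def by blast
    then show False
      using deficient_null[of \<mu> n] E(1) unfolding msupport_def by fastforce
  qed
  then have "emeasure \<nu> (?E \<inter> full_shift k) = 0"
    using sub by (intro null_if_disjoint_msupport[OF \<nu> E(2)]) blast
  then have "AE \<omega> in \<nu>. \<omega> \<notin> ?E \<inter> full_shift k"
    using invariant_measure_open[OF \<nu> E(1)] by (intro AE_not_in) auto
  moreover have "AE \<omega> in \<nu>. \<omega> \<in> full_shift k"
    using AE_space[of \<nu>] by (simp add: invariant_measure_space[OF \<nu>])
  ultimately have "AE \<omega> in \<nu>. real n * top_rate - (5 * C + 1) \<le> a n \<omega>"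
    by eventually_elim (auto simp: deficient_def)
  then show "real n * top_rate - (5 * C + 1) \<le> (\<integral>\<omega>. a n \<omega> \<partial>\<nu>)"
    by (intro integral_ge_const locally_constant_integrable[OF \<nu> locally_constant_a])
qed

text \<open>For each member of a countable basis that meets the maximizing set, pick a maximizing measure
  charging it. The mixture of these measures is again maximizing, and its support contains the
  closure of the union of all maximizing supports.\<close>

lemma maximizing_set_eq_msupport:
  obtains \<nu> where "\<nu> \<in> invariant_measures k" "lam \<nu> = top_rate" "maximizing_set = msupport k \<nu>"
proof -
  obtain B :: "(int \<Rightarrow> nat) set set" where B: "countable B" "topological_basis B"
    using ex_countable_basis by blast
  define B' where "B' = {U \<in> B. U \<inter> maximizing_set \<noteq> {}}"
  obtain \<mu>0 where \<mu>0: "\<mu>0 \<in> invariant_measures k" "lam \<mu>0 = top_rate"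
    by (rule maximizing_measure_exists)
  then obtain x0 where "x0 \<in> maximizing_set"
    using msupport_nonempty unfolding maximizing_set_def by blast
  have B_in: "\<exists>V\<in>B'. x \<in> V \<and> V \<subseteq> U" if "open U" "x \<in> U" "x \<in> maximizing_set" for U x
  proof -
    obtain V where "V \<in> B" "x \<in> V" "V \<subseteq> U"
      by (rule topological_basisE[OF B(2) \<open>open U\<close> \<open>x \<in> U\<close>])
    then show ?thesis using \<open>x \<in> maximizing_set\<close> unfolding B'_def by blast
  qed
  have "B' \<noteq> {}" using B_in[of UNIV x0] \<open>x0 \<in> maximizing_set\<close> by auto
  have "countable B'" using B(1) by (simp add: B'_def)
  define good where "good U \<mu> \<longleftrightarrow> \<mu> \<in> invariant_measures k \<and> lam \<mu> = top_rate
    \<and> emeasure \<mu> (U \<inter> full_shift k) > 0" for U \<mu>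
  have ex_good: "\<exists>\<mu>. good U \<mu>" if U: "U \<in> B'" for U
  proof -
    have "open U" using U topological_basis_open[OF B(2)] unfolding B'_def by blast
    moreover obtain x \<mu> where "x \<in> U" "\<mu> \<in> invariant_measures k" "lam \<mu> = top_rate" "x \<in> msupport k \<mu>"
      using U unfolding B'_def maximizing_set_def by blast
    ultimately show ?thesis unfolding msupport_def good_def by blast
  qed
  define \<mu> where "\<mu> i = (SOME \<mu>. good (from_nat_into B' i) \<mu>)" for i
  have "good (from_nat_into B' i) (\<mu> i)" for i
    unfolding \<mu>_def by (rule someI_ex[OF ex_good[OF from_nat_into[OF \<open>B' \<noteq> {}\<close>]]])
  then have \<mu>: "\<And>i. \<mu> i \<in> invariant_measures k" "\<And>i. lam (\<mu> i) = top_rate"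
    and pos: "\<And>i. emeasure (\<mu> i) (from_nat_into B' i \<inter> full_shift k) > 0"
    unfolding good_def by simp_all
  obtain \<nu> where \<nu>: "\<nu> \<in> invariant_measures k"
    and \<nu>_pos: "\<And>U i. open U \<Longrightarrow> emeasure (\<mu> i) (U \<inter> full_shift k) > 0 \<Longrightarrow> emeasure \<nu> (U \<inter> full_shift k) > 0"
    and \<nu>_int: "\<And>f c. locally_constant (f :: _ \<Rightarrow> real) \<Longrightarrow> (\<And>i. c \<le> (\<integral>x. f x \<partial>\<mu> i)) \<Longrightarrow> c \<le> (\<integral>x. f x \<partial>\<nu>)"
    by (rule countable_mixture[of \<mu> k, OF \<mu>(1)]) blast
  have max: "lam \<nu> = top_rate"
  proof (rule lam_eq_top_rateI[OF \<nu>], rule \<nu>_int[OF locally_constant_a])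
    show "real n * top_rate - C \<le> (\<integral>\<omega>. a n \<omega> \<partial>\<mu> i)" for n i
      using lam_approx[OF \<mu>(1), of i n] by (simp add: \<mu>(2) abs_le_iff)
  qed
  have "maximizing_set = msupport k \<nu>"
  proof
    show "msupport k \<nu> \<subseteq> maximizing_set"
      using \<nu> max unfolding maximizing_set_def by blast
    show "maximizing_set \<subseteq> msupport k \<nu>"
    proof
      fix x assume x: "x \<in> maximizing_set"
      have "emeasure \<nu> (U \<inter> full_shift k) > 0" if U: "open U" "x \<in> U" for U
      proof -
        obtain V where V: "V \<in> B'" "V \<subseteq> U" using B_in[OF U x] by blast
        have "open V" using V(1) topological_basis_open[OF B(2)] unfolding B'_def by blast
        obtain i where "V = from_nat_into B' i"
          using from_nat_into_surj[OF \<open>countable B'\<close> V(1)] by metis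
        then have "0 < emeasure \<nu> (V \<inter> full_shift k)"
          using pos[of i] by (intro \<nu>_pos[OF \<open>open V\<close>]) simp
        also have "\<dots> \<le> emeasure \<nu> (U \<inter> full_shift k)"
          using V(2) invariant_measure_open[OF \<nu> U(1)] by (intro emeasure_mono) auto
        finally show ?thesis .
      qed
      moreover have "x \<in> full_shift k"
        using x unfolding maximizing_set_def msupport_def by blast
      ultimately show "x \<in> msupport k \<nu>" unfolding msupport_def by blast
    qed
  qed
  then show ?thesis by (rule that[OF \<nu> max])
qed

theorem maximizing_set_properties:
  "compact maximizing_set" "maximizing_set \<noteq> {}" "left_shift ` maximizing_set = maximizing_set"
proof -
  obtain \<nu> where \<nu>: "\<nu> \<in> invariant_measures k" "maximizing_set = msupport k \<nu>"
    by (rule maximizing_set_eq_msupport)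
  show "compact maximizing_set" "maximizing_set \<noteq> {}" "left_shift ` maximizing_set = maximizing_set"
    unfolding \<nu>(2)
    by (rule compact_msupport[OF \<nu>(1)] msupport_nonempty[OF \<nu>(1)] left_shift_msupport[OF \<nu>(1)])+
qed

end

section \<open>Dominated cocycles\<close>

text \<open>Minimizing is maximizing for the negative, and almost additivity is symmetric under sign change.\<close>

lemma (in almost_additive_potential) uminus_potential:
  "almost_additive_potential k (\<lambda>n \<omega>. - a n \<omega>) C (\<lambda>\<mu>. - lam \<mu>)"
proof
  show "- a n \<omega> = - a n \<omega>'" if "\<And>i. i < n \<Longrightarrow> \<omega> (int i) = \<omega>' (int i)" for n \<omega> \<omega>'
    using a_word[of n \<omega> \<omega>', OF that] by simp
  show "\<bar>- a (n + m) \<omega> - - a n \<omega> - - a m ((left_shift ^^ n) \<omega>)\<bar> \<le> C"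
    if "\<omega> \<in> full_shift k" for n m \<omega>
    using a_add[OF that, of n m] by linarith
  show "\<bar>(\<integral>\<omega>. - a n \<omega> \<partial>\<mu>) - real n * - lam \<mu>\<bar> \<le> C" if "\<mu> \<in> invariant_measures k" for \<mu> n
    using lam_approx[OF that, of n] by simp
qed (rule k_pos)

lemma cocycle_prod_add:
  "cocycle_prod A (n + m) \<omega> = cocycle_prod A m ((left_shift ^^ n) \<omega>) ** cocycle_prod A n \<omega>"
  by (induction m) (simp_all add: left_shift_funpow matrix_mul_assoc add.commute)

lemma cocycle_prod_word:
  "(\<And>i. i < n \<Longrightarrow> \<omega> (int i) = \<omega>' (int i)) \<Longrightarrow> cocycle_prod A n \<omega> = cocycle_prod A n \<omega>'"
  by (induction n) simp_all

lemma invertible_cocycle_prod: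
  assumes "\<And>i. i \<in> {1..k} \<Longrightarrow> invertible (A i)" "\<omega> \<in> full_shift k"
  shows "invertible (cocycle_prod A n \<omega>)"
proof (induction n)
  case 0
  show ?case by (simp add: invertible_def exI[of _ "mat 1"])
next
  case (Suc n)
  have "invertible (A (\<omega> (int n)))"
    using assms by (auto simp: full_shift_def)
  then show ?case using Suc by (simp add: invertible_mult)
qed

lemma line_eq_span:
  fixes E :: "'a::euclidean_space set"
  assumes "subspace E" "dim E = 1" "v \<in> E" "v \<noteq> 0"
  shows "E = span {v}"
proof (rule subspace_dim_equal[symmetric])
  show "span {v} \<subseteq> E" using assms(1,3) by (simp add: span_minimal)
  show "dim E \<le> dim (span {v})" using assms(2,4) by simp
qed (use assms in auto)

lemma norm_on_line:
  assumes E: "subspace E" "dim E = 1" and v: "v \<in> E" "v \<noteq> 0"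
  shows "norm_on M E = norm (M *v v) / norm v"
  unfolding norm_on_def
proof (rule cSup_eq_maximum)
  show "norm (M *v v) / norm v \<in> (\<lambda>v. norm (M *v v) / norm v) ` E" using v(1) by blast
  fix x assume "x \<in> (\<lambda>v. norm (M *v v) / norm v) ` E"
  then obtain w where w: "w \<in> span {v}" "x = norm (M *v w) / norm w"
    unfolding line_eq_span[OF E v] by blast
  then obtain t where t: "w = t *\<^sub>R v" by (auto simp: span_singleton)
  have "M *v w = t *\<^sub>R (M *v v)"
    unfolding t by (simp add: matrix_vector_mult_scaleR)
  then show "x \<le> norm (M *v v) / norm v"
    using w(2) t by simp
qed

lemma unit_vector_in_line:
  fixes E :: "'a::euclidean_space set"
  assumes "subspace E" "dim E = 1"
  shows "\<exists>u\<in>E. norm u = 1"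
proof -
  have "\<not> E \<subseteq> {0}" using assms(2) dim_eq_0[of E] by simp
  then obtain v where "v \<in> E" "v \<noteq> 0" by blast
  then show ?thesis
    using assms(1) by (intro bexI[of _ "v /\<^sub>R norm v"]) (auto simp: subspace_scale)
qed

text \<open>A fixed invertible matrix cannot stretch two nearly equal unit vectors by very different factors.\<close>

lemma separated_if_norms_separated:
  fixes N :: "real^'n^'n"
  assumes "invertible N"
  obtains \<eta> where "\<eta> > 0"
    "\<And>u v. norm u = 1 \<Longrightarrow> norm v = 1 \<Longrightarrow> 2 * norm (N *v v) \<le> norm (N *v u) \<Longrightarrow> \<eta> \<le> norm (u - v)"
proof -
  obtain N' where N': "N' ** N = mat 1" using assms unfolding invertible_def by blast
  obtain L where L: "L > 0" "\<And>x. norm (N *v x) \<le> norm x * L"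
    using bounded_linear.pos_bounded[OF matrix_vector_mul_bounded_linear[of N]] by blast
  obtain L' where L': "L' > 0" "\<And>x. norm (N' *v x) \<le> norm x * L'"
    using bounded_linear.pos_bounded[OF matrix_vector_mul_bounded_linear[of N']] by blast
  show ?thesis
  proof (rule that[of "1 / (2 * L * L')"])
    show "1 / (2 * L * L') > 0" using L(1) L'(1) by simp
    fix u v :: "real^'n" assume u: "norm u = 1" and le: "2 * norm (N *v v) \<le> norm (N *v u)"
    have "u = N' *v (N *v u)" using N' by (simp add: matrix_vector_mul_assoc)
    then have "1 \<le> norm (N *v u) * L'" using L'(2)[of "N *v u"] u by metis
    moreover have "norm (N *v u) \<le> 2 * norm (N *v (u - v))"
      using le norm_triangle_ineq2[of "N *v u" "N *v v"] by (simp add: matrix_vector_mult_diff_distrib)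
    moreover have "norm (N *v (u - v)) \<le> norm (u - v) * L" by (rule L(2))
    ultimately have "1 \<le> 2 * (norm (u - v) * L) * L'"
      using L'(1) by (meson less_eq_real_def mult_left_mono mult_right_mono order_trans zero_le_numeral)
    then show "1 / (2 * L * L') \<le> norm (u - v)"
      using L(1) L'(1) by (simp add: divide_le_eq algebra_simps)
  qed
qed

text \<open>The two separation hypotheses keep the inner product of \<open>u\<close> and \<open>v\<close> away from \<open>1\<close> and from
  \<open>- 1\<close>, so the Gram matrix of \<open>u\<close> and \<open>v\<close> has smallest eigenvalue at least \<open>\<eta>\<^sup>2 / 2\<close>.\<close>

lemma coefficient_le_of_separated:
  fixes u v :: "'a::real_inner"
  assumes unit: "norm u = 1" "norm v = 1" and \<eta>: "0 < \<eta>" "\<eta> \<le> norm (u - v)" "\<eta> \<le> norm (u + v)"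
  shows "\<eta> * \<bar>s\<bar> \<le> 2 * norm (s *\<^sub>R u + t *\<^sub>R v)"
proof -
  define w where "w = s *\<^sub>R u + t *\<^sub>R v"
  define i where "i = u \<bullet> v"
  have uu: "u \<bullet> u = 1" "v \<bullet> v = 1" using unit by (simp_all add: norm_eq_1)
  have w2: "(norm w)\<^sup>2 = s\<^sup>2 + t\<^sup>2 + 2 * (s * t) * i"
    unfolding power2_norm_eq_inner w_def i_def
    by (simp add: inner_add_left inner_add_right uu inner_commute power2_eq_square algebra_simps)
  have "\<eta>\<^sup>2 \<le> (norm (u - v))\<^sup>2" "\<eta>\<^sup>2 \<le> (norm (u + v))\<^sup>2"
    using \<eta> by (simp_all add: power_mono)
  then have "\<eta>\<^sup>2 \<le> 2 - 2 * i" "\<eta>\<^sup>2 \<le> 2 + 2 * i"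
    unfolding power2_norm_eq_inner i_def
    by (simp_all add: inner_add_left inner_add_right inner_diff_left inner_diff_right uu inner_commute)
  then have i: "\<bar>i\<bar> \<le> 1 - \<eta>\<^sup>2 / 2" by linarith
  have "\<bar>2 * (s * t)\<bar> \<le> s\<^sup>2 + t\<^sup>2"
    using sum_squares_bound[of s t] sum_squares_bound[of s "- t"] by (simp add: abs_le_iff)
  then have "\<bar>2 * (s * t) * i\<bar> \<le> (s\<^sup>2 + t\<^sup>2) * (1 - \<eta>\<^sup>2 / 2)"
    using i unfolding abs_mult[of "2 * (s * t)" i] by (intro mult_mono) auto
  then have "(s\<^sup>2 + t\<^sup>2) * (\<eta>\<^sup>2 / 2) \<le> (norm w)\<^sup>2"
    unfolding w2 by (simp add: algebra_simps abs_le_iff)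
  moreover have "s\<^sup>2 * (\<eta>\<^sup>2 / 2) \<le> (s\<^sup>2 + t\<^sup>2) * (\<eta>\<^sup>2 / 2)"
    by (intro mult_right_mono) auto
  moreover have "(\<eta> * \<bar>s\<bar>)\<^sup>2 = 2 * (s\<^sup>2 * (\<eta>\<^sup>2 / 2))" "(2 * norm w)\<^sup>2 = 4 * (norm w)\<^sup>2"
    by (simp_all add: power_mult_distrib)
  ultimately have "(\<eta> * \<bar>s\<bar>)\<^sup>2 \<le> (2 * norm w)\<^sup>2"
    using zero_le_power2[of "norm w"] by linarith
  then show ?thesis
    unfolding w_def by (rule power2_le_imp_le) simp
qed

text \<open>The function \<open>p\<close> is the norm of the product along the dominating line \<open>e1\<close>. It is multiplicative
  because \<open>e1\<close> is equivariant and one-dimensional. It controls the full operator norm because the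
  second line is stretched less, up to the factor \<open>1 / c\<close>, and because vectors decompose along the
  two lines with bounded coefficients; the latter needs a uniform lower bound on the angle.\<close>

lemma dominated_multiplicative_minorant:
  assumes inv: "\<And>i. i \<in> {1..k} \<Longrightarrow> invertible (A i)" and dom: "dominated k A"
  shows "\<exists>K\<ge>1. \<exists>p :: nat \<Rightarrow> (int \<Rightarrow> nat) \<Rightarrow> real. \<forall>\<omega>\<in>full_shift k. \<forall>n.
    0 < p n \<omega> \<and> p n \<omega> \<le> onorm ((*v) (cocycle_prod A n \<omega>)) \<and>
    onorm ((*v) (cocycle_prod A n \<omega>)) \<le> K * p n \<omega> \<and>
    (\<forall>m. p (n + m) \<omega> = p n \<omega> * p m ((left_shift ^^ n) \<omega>))"
proof -
  obtain e1 e2 :: "(int \<Rightarrow> nat) \<Rightarrow> (real^2) set" and c \<delta> where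
    spl: "\<And>\<omega>. \<omega> \<in> full_shift k \<Longrightarrow> splitting (e1 \<omega>) (e2 \<omega>)"
    and e1: "\<And>\<omega>. \<omega> \<in> full_shift k \<Longrightarrow> (*v) (A (\<omega> 0)) ` e1 \<omega> = e1 (left_shift \<omega>)"
    and c: "c > 0" and \<delta>: "\<delta> > 0"
    and gap: "\<And>\<omega> n. \<omega> \<in> full_shift k \<Longrightarrow> n \<ge> 1 \<Longrightarrow>
       norm_on (cocycle_prod A n \<omega>) (e1 \<omega>) \<ge> c * exp (\<delta> * real n) * norm_on (cocycle_prod A n \<omega>) (e2 \<omega>)"
    using dom unfolding dominated_def by metis
  have line: "subspace (e1 \<omega>)" "dim (e1 \<omega>) = 1" "subspace (e2 \<omega>)" "dim (e2 \<omega>) = 1"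
    and sum: "{x + y | x y. x \<in> e1 \<omega> \<and> y \<in> e2 \<omega>} = UNIV" if "\<omega> \<in> full_shift k" for \<omega>
    using spl[OF that] unfolding splitting_def by auto
  have "\<exists>u. \<omega> \<in> full_shift k \<longrightarrow> u \<in> e1 \<omega> \<and> norm u = 1"
    "\<exists>v. \<omega> \<in> full_shift k \<longrightarrow> v \<in> e2 \<omega> \<and> norm v = 1" for \<omega>
    using unit_vector_in_line line by metis+
  then obtain u v where u: "\<And>\<omega>. \<omega> \<in> full_shift k \<Longrightarrow> u \<omega> \<in> e1 \<omega>" "\<And>\<omega>. \<omega> \<in> full_shift k \<Longrightarrow> norm (u \<omega>) = 1"
    and v: "\<And>\<omega>. \<omega> \<in> full_shift k \<Longrightarrow> v \<omega> \<in> e2 \<omega>" "\<And>\<omega>. \<omega> \<in> full_shift k \<Longrightarrow> norm (v \<omega>) = 1"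
    by metis
  define p q where "p n \<omega> = norm (cocycle_prod A n \<omega> *v u \<omega>)"
    and "q n \<omega> = norm (cocycle_prod A n \<omega> *v v \<omega>)" for n \<omega>
  have span1: "e1 \<omega> = span {u \<omega>}" and span2: "e2 \<omega> = span {v \<omega>}" if "\<omega> \<in> full_shift k" for \<omega>
    using line_eq_span line[OF that] u[OF that] v[OF that] by force+
  have norm_on_p: "norm_on (cocycle_prod A n \<omega>) (e1 \<omega>) = p n \<omega>"
    and norm_on_q: "norm_on (cocycle_prod A n \<omega>) (e2 \<omega>) = q n \<omega>" if "\<omega> \<in> full_shift k" for n \<omega>
    using norm_on_line[of "e1 \<omega>" "u \<omega>"] norm_on_line[of "e2 \<omega>" "v \<omega>"] line[OF that] u[OF that] v[OF that]
    unfolding p_def q_def by force+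
  have e1_iter: "cocycle_prod A n \<omega> *v x \<in> e1 ((left_shift ^^ n) \<omega>)"
    if w: "\<omega> \<in> full_shift k" and x: "x \<in> e1 \<omega>" for n \<omega> x
  proof (induction n)
    case (Suc n)
    have "A (((left_shift ^^ n) \<omega>) 0) *v (cocycle_prod A n \<omega> *v x) \<in> e1 (left_shift ((left_shift ^^ n) \<omega>))"
      using e1[OF left_shift_funpow_full_shift[OF w, of n]] Suc by blast
    then show ?case
      by (simp add: left_shift_funpow matrix_vector_mul_assoc)
  qed (use x in simp)
  have p_pos: "0 < p n \<omega>" if w: "\<omega> \<in> full_shift k" for n \<omega>
  proof -
    obtain N' where "N' ** cocycle_prod A n \<omega> = mat 1"
      using invertible_cocycle_prod[of k A \<omega> n, OF inv w] unfolding invertible_def by blast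
    then have "N' *v (cocycle_prod A n \<omega> *v u \<omega>) = u \<omega>" by (simp add: matrix_vector_mul_assoc)
    then have "cocycle_prod A n \<omega> *v u \<omega> \<noteq> 0" using u(2)[OF w] by auto
    then show ?thesis by (simp add: p_def)
  qed
  have p_le: "p n \<omega> \<le> onorm ((*v) (cocycle_prod A n \<omega>))" if w: "\<omega> \<in> full_shift k" for n \<omega>
    using onorm[OF matrix_vector_mul_bounded_linear, of "cocycle_prod A n \<omega>" "u \<omega>"] u(2)[OF w]
    by (simp add: p_def)
  have p_mult: "p (n + m) \<omega> = p n \<omega> * p m ((left_shift ^^ n) \<omega>)" if w: "\<omega> \<in> full_shift k" for n m \<omega>
  proof -
    let ?\<omega>' = "(left_shift ^^ n) \<omega>"
    have w': "?\<omega>' \<in> full_shift k" by (rule left_shift_funpow_full_shift[OF w])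
    obtain t where t: "cocycle_prod A n \<omega> *v u \<omega> = t *\<^sub>R u ?\<omega>'"
      using e1_iter[OF w u(1)[OF w], of n] unfolding span1[OF w'] by (auto simp: span_singleton)
    have "p n \<omega> = \<bar>t\<bar>" unfolding p_def t using u(2)[OF w'] by simp
    moreover have "cocycle_prod A (n + m) \<omega> *v u \<omega> = t *\<^sub>R (cocycle_prod A m ?\<omega>' *v u ?\<omega>')"
      by (simp add: cocycle_prod_add t matrix_vector_mult_scaleR flip: matrix_vector_mul_assoc)
    ultimately show ?thesis by (simp add: p_def)
  qed
  \<comment> \<open>A time at which the expansion along \<open>e1\<close> is at least twice the one along \<open>e2\<close> forces a
    lower bound on the angle between the two lines.\<close>
  obtain n0 :: nat where n0: "n0 \<ge> 1" "c * exp (\<delta> * real n0) \<ge> 2"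
  proof -
    obtain n :: nat where n: "real n > ln (2 / c) / \<delta>" using reals_Archimedean2 by blast
    have "ln (2 / c) \<le> \<delta> * real (Suc n)" using n \<delta> by (simp add: field_simps)
    then have "2 / c \<le> exp (\<delta> * real (Suc n))"
      using c by (metis divide_pos_pos exp_le_cancel_iff exp_ln zero_less_numeral)
    then have "2 \<le> c * exp (\<delta> * real (Suc n))"
      using c by (simp add: pos_divide_le_eq mult.commute)
    then show ?thesis using that[of "Suc n"] by simp
  qed
  have finF: "finite (cocycle_prod A n0 ` full_shift k)"
    by (rule locally_constant_finite_image[OF _ compact_full_shift],
        rule locally_constantI_cylinder[of "int ` {..<n0}"]) (auto intro: cocycle_prod_word)
  have "\<exists>\<eta>>0. \<forall>x y. norm x = 1 \<longrightarrow> norm y = 1 \<longrightarrow> 2 * norm (N *v y) \<le> norm (N *v x) \<longrightarrow> \<eta> \<le> norm (x - y)"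
    if "N \<in> cocycle_prod A n0 ` full_shift k" for N
  proof -
    obtain \<omega> where w: "\<omega> \<in> full_shift k" and N: "N = cocycle_prod A n0 \<omega>"
      using \<open>N \<in> cocycle_prod A n0 ` full_shift k\<close> by blast
    have "invertible N" unfolding N by (rule invertible_cocycle_prod[of k A, OF inv w])
    from separated_if_norms_separated[OF this] show ?thesis by metis
  qed
  then obtain h where h: "\<And>N. N \<in> cocycle_prod A n0 ` full_shift k \<Longrightarrow> h N > 0"
    "\<And>N x y. N \<in> cocycle_prod A n0 ` full_shift k \<Longrightarrow> norm x = 1 \<Longrightarrow> norm y = 1 \<Longrightarrow>
       2 * norm (N *v y) \<le> norm (N *v x) \<Longrightarrow> h N \<le> norm (x - y)"
    by metis
  define \<eta> where "\<eta> = Min (insert 1 (h ` cocycle_prod A n0 ` full_shift k))"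
  have \<eta>_pos: "\<eta> > 0"
    unfolding \<eta>_def using finF h(1) by (subst Min_gr_iff) auto
  have \<eta>_le: "\<eta> \<le> h (cocycle_prod A n0 \<omega>)" if "\<omega> \<in> full_shift k" for \<omega>
    unfolding \<eta>_def using finF that by (intro Min_le) auto
  have sep: "\<eta> \<le> norm (u \<omega> - v \<omega>)" "\<eta> \<le> norm (u \<omega> + v \<omega>)" if w: "\<omega> \<in> full_shift k" for \<omega>
  proof -
    let ?N = "cocycle_prod A n0 \<omega>"
    have "2 * q n0 \<omega> \<le> c * exp (\<delta> * real n0) * q n0 \<omega>"
      using n0(2) by (intro mult_right_mono) (auto simp: q_def)
    also have "\<dots> \<le> p n0 \<omega>"
      using gap[OF w n0(1)] unfolding norm_on_p[OF w] norm_on_q[OF w] .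
    finally have le: "2 * norm (?N *v v \<omega>) \<le> norm (?N *v u \<omega>)" by (simp add: p_def q_def)
    have "norm (?N *v (- v \<omega>)) = norm (?N *v v \<omega>)"
      by (metis diff_0 matrix_vector_mult_0_right matrix_vector_mult_diff_distrib norm_minus_cancel)
    then have le': "2 * norm (?N *v (- v \<omega>)) \<le> norm (?N *v u \<omega>)" using le by simp
    show "\<eta> \<le> norm (u \<omega> - v \<omega>)"
      using h(2)[OF imageI[OF w] u(2)[OF w] v(2)[OF w] le] \<eta>_le[OF w] by simp
    show "\<eta> \<le> norm (u \<omega> + v \<omega>)"
      using h(2)[OF imageI[OF w] u(2)[OF w] _ le'] v(2)[OF w] \<eta>_le[OF w] by simp
  qed
  \<comment> \<open>The summand \<open>1\<close> covers \<open>n = 0\<close>, where the gap is not available.\<close>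
  define K where "K = 1 + (2 / \<eta>) * (1 + 1 / c)"
  have K: "K \<ge> 1" unfolding K_def using \<eta>_pos c by simp
  have le_K: "onorm ((*v) (cocycle_prod A n \<omega>)) \<le> K * p n \<omega>" if w: "\<omega> \<in> full_shift k" for n \<omega>
  proof (rule onorm_bound)
    show "0 \<le> K * p n \<omega>" using K p_pos[OF w, of n] by simp
    fix x :: "real^2"
    let ?N = "cocycle_prod A n \<omega>"
    show "norm (?N *v x) \<le> K * p n \<omega> * norm x"
    proof (cases "n = 0")
      case True
      then have "p n \<omega> = 1" using u(2)[OF w] by (simp add: p_def)
      then show ?thesis using True K mult_right_mono[OF K, of "norm x"] by simp
    next
      case False
      have "q n \<omega> * c \<le> c * exp (\<delta> * real n) * q n \<omega>"
        using c \<delta> mult_right_mono[of 1 "exp (\<delta> * real n)" "c * q n \<omega>"] by (simp add: q_def mult_ac)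
      also have "\<dots> \<le> p n \<omega>"
        using gap[OF w, of n] False unfolding norm_on_p[OF w] norm_on_q[OF w] by simp
      finally have q_le: "q n \<omega> \<le> p n \<omega> / c" using c by (simp add: le_divide_eq)
      have "x \<in> {x + y | x y. x \<in> e1 \<omega> \<and> y \<in> e2 \<omega>}" unfolding sum[OF w] by simp
      then obtain y z where yz: "x = y + z" "y \<in> e1 \<omega>" "z \<in> e2 \<omega>" by blast
      then obtain s t where x: "x = s *\<^sub>R u \<omega> + t *\<^sub>R v \<omega>"
        unfolding span1[OF w] span2[OF w] by (auto simp: span_singleton)
      have "\<eta> * \<bar>s\<bar> \<le> 2 * norm x"
        unfolding x using coefficient_le_of_separated[OF u(2)[OF w] v(2)[OF w] \<eta>_pos sep[OF w]] .
      moreover have "\<eta> * \<bar>t\<bar> \<le> 2 * norm x"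
        unfolding x add.commute[of "s *\<^sub>R u \<omega>"]
        using sep[OF w] by (intro coefficient_le_of_separated u v w \<eta>_pos)
          (simp_all add: norm_minus_commute add.commute)
      ultimately have s: "\<bar>s\<bar> \<le> (2 / \<eta>) * norm x" and t: "\<bar>t\<bar> \<le> (2 / \<eta>) * norm x"
        using \<eta>_pos by (simp_all add: field_simps)
      have "?N *v x = s *\<^sub>R (?N *v u \<omega>) + t *\<^sub>R (?N *v v \<omega>)"
        by (simp add: x matrix_vector_right_distrib matrix_vector_mult_scaleR)
      then have "norm (?N *v x) \<le> \<bar>s\<bar> * p n \<omega> + \<bar>t\<bar> * q n \<omega>"
        unfolding p_def q_def by (metis norm_scaleR norm_triangle_ineq)
      also have "\<dots> \<le> ((2 / \<eta>) * norm x) * p n \<omega> + ((2 / \<eta>) * norm x) * (p n \<omega> / c)"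
        using s t q_le p_pos[OF w, of n] \<eta>_pos by (intro add_mono mult_mono) (auto simp: q_def)
      also have "\<dots> = (K - 1) * p n \<omega> * norm x"
        unfolding K_def by (simp add: algebra_simps add_divide_distrib)
      also have "\<dots> \<le> K * p n \<omega> * norm x"
        using p_pos[OF w, of n] by (intro mult_right_mono) auto
      finally show ?thesis .
    qed
  qed
  show ?thesis
    using K p_pos p_le le_K p_mult by (intro exI[of _ K] conjI exI[of _ p] ballI allI)
qed

definition log_norm :: "(nat \<Rightarrow> real^2^2) \<Rightarrow> nat \<Rightarrow> (int \<Rightarrow> nat) \<Rightarrow> real" where
  "log_norm A n \<omega> = ln (onorm ((*v) (cocycle_prod A n \<omega>)))"

text \<open>The logarithm of the norm lies between \<open>ln p\<close> and \<open>ln p + ln K\<close>, and \<open>ln p\<close> is additive along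
  orbits. The ergodic theorem for almost additive processes identifies the Lyapunov exponent as the
  growth rate.\<close>

lemma dominated_almost_additive_potential:
  assumes k: "k \<ge> 1" and inv: "\<And>i. i \<in> {1..k} \<Longrightarrow> invertible (A i)" and dom: "dominated k A"
  obtains C where "almost_additive_potential k (log_norm A) C (lyap A)"
proof -
  obtain K and p :: "nat \<Rightarrow> (int \<Rightarrow> nat) \<Rightarrow> real" where K: "K \<ge> 1"
    and pos: "\<And>n \<omega>. \<omega> \<in> full_shift k \<Longrightarrow> 0 < p n \<omega>"
    and le: "\<And>n \<omega>. \<omega> \<in> full_shift k \<Longrightarrow> p n \<omega> \<le> onorm ((*v) (cocycle_prod A n \<omega>))"
    and le_K: "\<And>n \<omega>. \<omega> \<in> full_shift k \<Longrightarrow> onorm ((*v) (cocycle_prod A n \<omega>)) \<le> K * p n \<omega>"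
    and mult: "\<And>n m \<omega>. \<omega> \<in> full_shift k \<Longrightarrow> p (n + m) \<omega> = p n \<omega> * p m ((left_shift ^^ n) \<omega>)"
    using dominated_multiplicative_minorant[of k A, OF inv dom] by metis
  define C where "C = 2 * ln K"
  have C: "0 \<le> C" using K by (simp add: C_def)
  have ge: "ln (p n \<omega>) \<le> log_norm A n \<omega>" if "\<omega> \<in> full_shift k" for n \<omega>
    unfolding log_norm_def using pos[OF that, of n] le[OF that, of n] by simp
  have upper: "log_norm A n \<omega> \<le> ln (p n \<omega>) + ln K" if "\<omega> \<in> full_shift k" for n \<omega>
  proof -
    have "log_norm A n \<omega> \<le> ln (K * p n \<omega>)"
      unfolding log_norm_def using pos[OF that, of n] le[OF that, of n] le_K[OF that, of n] K
      by (subst ln_le_cancel_iff) auto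
    then show ?thesis using K pos[OF that, of n] by (simp add: ln_mult)
  qed
  have add: "\<bar>log_norm A (n + m) \<omega> - log_norm A n \<omega> - log_norm A m ((left_shift ^^ n) \<omega>)\<bar> \<le> C"
    if w: "\<omega> \<in> full_shift k" for n m \<omega>
  proof -
    have w': "(left_shift ^^ n) \<omega> \<in> full_shift k" by (rule left_shift_funpow_full_shift[OF w])
    have "ln (p (n + m) \<omega>) = ln (p n \<omega>) + ln (p m ((left_shift ^^ n) \<omega>))"
      unfolding mult[OF w] using pos[OF w, of n] pos[OF w', of m] by (simp add: ln_mult)
    then show ?thesis
      using ge[OF w, of "n + m"] upper[OF w, of "n + m"] ge[OF w, of n] upper[OF w, of n]
        ge[OF w', of m] upper[OF w', of m] ln_ge_zero[OF K]
      unfolding C_def abs_le_iff by linarith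
  qed
  have word: "log_norm A n \<omega> = log_norm A n \<omega>'"
    if "\<And>i. i < n \<Longrightarrow> \<omega> (int i) = \<omega>' (int i)" for n \<omega> \<omega>'
    using cocycle_prod_word[of n \<omega> \<omega>' A] that by (simp add: log_norm_def)
  have lc: "locally_constant (log_norm A n)" for n
    by (rule locally_constantI_cylinder[of "int ` {..<n}"]) (auto intro: word)
  have fin: "finite (log_norm A 1 ` full_shift k)"
    by (rule locally_constant_finite_image[OF lc compact_full_shift])
  define B where "B = Max (abs ` log_norm A 1 ` full_shift k) + C"
  have one: "\<bar>log_norm A 1 \<omega>\<bar> + C \<le> B" if "\<omega> \<in> full_shift k" for \<omega>
    unfolding B_def using fin that by simp
  have bound: "\<bar>log_norm A n \<omega>\<bar> \<le> B * real n" if w: "\<omega> \<in> full_shift k" for n \<omega>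
  proof (induction n)
    case 0
    have "(*v) (mat 1) = (\<lambda>x::real^2. x)" by auto
    then show ?case by (simp add: log_norm_def onorm_id)
  next
    case (Suc n)
    have "\<bar>log_norm A (Suc n) \<omega>\<bar> \<le> \<bar>log_norm A n \<omega>\<bar> + (\<bar>log_norm A 1 ((left_shift ^^ n) \<omega>)\<bar> + C)"
      using add[OF w, of n 1] by simp
    also have "\<dots> \<le> B * real n + B"
      using Suc one[OF left_shift_funpow_full_shift[OF w]] by (rule add_mono)
    finally show ?case by (simp add: algebra_simps)
  qed
  have "almost_additive_potential k (log_norm A) C (lyap A)"
  proof
    fix \<mu> n assume \<mu>: "\<mu> \<in> invariant_measures k"
    interpret prob_space \<mu> by (rule invariant_measure_prob[OF \<mu>])
    interpret almost_additive_process \<mu> left_shift "log_norm A" C B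
    proof
      show "left_shift \<in> measurable \<mu> \<mu>" "distr \<mu> \<mu> left_shift = \<mu>"
        by (rule invariant_measure_meas[OF \<mu>] invariant_measure_distr[OF \<mu>])+
      show "log_norm A n \<in> borel_measurable \<mu>" for n
        by (rule locally_constant_measurable[OF \<mu> lc])
    qed (use add bound in \<open>simp_all add: invariant_measure_space[OF \<mu>]\<close>)
    show "\<bar>(\<integral>\<omega>. log_norm A n \<omega> \<partial>\<mu>) - real n * lyap A \<mu>\<bar> \<le> C"
      using integral_lim_approx[of n] by (simp add: lyap_def lyap_pt_def log_norm_def)
  qed (fact k word add)+
  then show ?thesis by (rule that)
qed

theorem theorem1:
  fixes k :: nat and A :: "nat \<Rightarrow> real^2^2"
  assumes "k \<ge> 2"
    and "\<And>i. i \<in> {1..k} \<Longrightarrow> invertible (A i)"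
    and "dominated k A"
  shows "\<forall>l \<in> {lyap_top k A, lyap_bot k A}.
           (compact (extremal_set k A l) \<and> extremal_set k A l \<noteq> {} \<and>
            left_shift ` extremal_set k A l = extremal_set k A l) \<and>
           (\<forall>\<mu>\<in>invariant_measures k.
              msupport k \<mu> \<subseteq> extremal_set k A l \<longrightarrow> lyap A \<mu> = l)"
proof -
  have "k \<ge> 1" using assms(1) by simp
  then obtain C where "almost_additive_potential k (log_norm A) C (lyap A)"
    using assms(2,3) by (rule dominated_almost_additive_potential)
  then interpret top: almost_additive_potential k "log_norm A" C "lyap A" .
  interpret bot: almost_additive_potential k "\<lambda>n \<omega>. - log_norm A n \<omega>" C "\<lambda>\<mu>. - lyap A \<mu>"
    by (rule top.uminus_potential)
  have l_top: "lyap_top k A = top.top_rate"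
    by (simp add: lyap_top_def top.top_rate_def)
  have l_bot: "lyap_bot k A = - bot.top_rate"
    by (simp add: lyap_bot_def bot.top_rate_def Inf_real_def image_image)
  have K_top: "extremal_set k A (lyap_top k A) = top.maximizing_set"
    by (simp add: extremal_set_def top.maximizing_set_def l_top)
  have "(- lyap A \<mu> = bot.top_rate) = (lyap A \<mu> = - bot.top_rate)" for \<mu> by auto
  then have K_bot: "extremal_set k A (lyap_bot k A) = bot.maximizing_set"
    by (simp add: extremal_set_def bot.maximizing_set_def l_bot)
  have "lyap A \<mu> = lyap_top k A"
    if "\<mu> \<in> invariant_measures k" "msupport k \<mu> \<subseteq> top.maximizing_set" for \<mu>
    using top.lam_eq_top_rate_if_msupport_subset[OF that] by (simp add: l_top)
  moreover have "lyap A \<mu> = lyap_bot k A"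
    if "\<mu> \<in> invariant_measures k" "msupport k \<mu> \<subseteq> bot.maximizing_set" for \<mu>
    using bot.lam_eq_top_rate_if_msupport_subset[OF that] by (simp add: l_bot)
  ultimately show ?thesis
    using top.maximizing_set_properties bot.maximizing_set_properties by (simp add: K_top K_bot)
qed

end
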